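(* Let $p\ge2$. Suppose a strong solver $\mathcal S_{\gamma,b}$ exists, with $0<\gamma\le1$, and $$a=(p-1)\gamma\le2,\qquad \tfrac32 a\ge1 .$$ Then the extrapolated inexact Halpern construction described in the context, with $$\alpha=\frac{\gamma}{1+\gamma},\qquad K=\max\{2,\lceil Q_R^{\alpha}\rceil\},\qquad Q_R=\frac{L_pR^p}{\varepsilon},$$ produces a residual solver $\mathcal A_{\alpha,b+4}$.
   Context: Class. $p\ge2$, $L_p,D>0$ known; $\mathcal X\subset\mathbb R^d$ known nonempty compact convex with $\operatorname{diam}\mathcal X\le D$. $\mathfrak F$ is the class of operators $F$ that are $C^{p-1}$ on an open neighborhood of $\mathcal X$, monotone on $\mathcal X$ ($\langle F(x)-F(y),x-y\rangle\ge0$) and with $\|D^{p-1}F(x)-D^{p-1}F(y)\|_{\mathrm{op}}\le L_p\|x-y\|$ on $\mathcal X$ ($\|\cdot\|_{\mathrm{op}}$ the multilinear operator norm). $G$ is $\mu$-strongly monotone if $\langle G(x)-G(y),x-y\rangle\ge\mu\|x-y\|^2$ on $\mathcal X$. $N_{\mathcal X}(x)=\{n:\langle n,z-x\rangle\le0\ \forall z\in\mathcal X\}$; a VI solution for $F$ is $z^\star\in\mathcal X$ with $0\in F(z^\star)+N_{\mathcal X}(z^\star)$. One query at $x\in\mathcal X$ returns $(F(x),DF(x),\dots,D^{p-1}F(x))$. Only queries to the unknown operator are counted; internal computation with returned data and the known domain (e.g. exact projections, exact solution of known VIs) is free. A jet of $F(z)+az+b$ with known affine part costs one query to $F$. A certificate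 of norm at most $\varepsilon$ is $(x,n,F(x))$ with $x\in\mathcal X$, $n\in N_{\mathcal X}(x)$, $F(x)$ evaluated, $\|F(x)+n\|\le\varepsilon$. Logarithmic factors. For $0<R\le D$, $\varepsilon,\mu,\delta>0$: $\mathcal L_{\mathrm A}(R,\varepsilon)=1+\log(2+\frac DR+\frac{L_pR^p}{\varepsilon})$, $\ \mathcal L_{\mathrm S}(\mu,\delta)=1+\log(2+\frac{L_pD^{p-1}}{\mu}+\frac{L_pD^p}{\delta}+\frac{\mu D}{\delta})$. Residual solver $\mathcal A_{\alpha,b}$: a deterministic algorithm which, on input $(F,x_0,R,\varepsilon)$ with $F\in\mathfrak F$, $x_0\in\mathcal X$, $0<R\le D$, and under the distance promise that some VI solution $z^\star$ satisfies $\|x_0-z^\star\|\le R$, returns a certificate of norm at most $\varepsilon$ using at most $C(1+Q_R^\alpha)\mathcal L_{\mathrm A}(R,\varepsilon)^b$ queries. It is budget capped: if its prescribed budget (of this size) is exhausted without a verified certificate it reports failure; the cap is charged before every original-oracle query, including in all descendant calls, and exhaustion aborts immediately. It never returns an unverified successful output, even under a false promise. Strong solver $\mathcal S_{\gamma,b}$: a deterministic algorithm which, on input $(G,w,\mu,\delta)$ with $G\in\mathfrak F$ $\mu$-strongly monotone, $w\in\mathcal X$, $\mu,\delta>0$, and not given $r=\|w-z^\star\|$ ($z^\star$ the VI solution for $G$), returns a certificate for $G$ of norm at most $\delta$ using at most $C\left[1+(L_pr^{p-1}/\mu)^\gamma\right]\mathcal L_{\mathrm S}(\mu,\delta)^b$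 queries (at $r=0$ the bracket is $1$). The leading constants $C$ are fixed, known, attached to the implementation, and depend only on $p$ (for the fixed exponents), not on the instance or dimension. Construction (inputs $F,x_0,R,\varepsilon$; integer $K\ge2$). Let $H_t=\sum_{i=1}^t1/i$ and $e=\frac{R}{(K+2)^4}$, $\eta=\frac{8R(1+H_{K+1})}{\varepsilon(K+1)}$, $\delta=\frac e\eta$. Install the query cap $$\mathsf B=\Big\lceil C_{\mathcal S}\,\mathcal L_{\mathrm S}(1/\eta,e/\eta)^b\,[K+1+(\eta L_p)^\gamma R^aU_a(K)]\Big\rceil+1,\qquad a=(p-1)\gamma,$$ where $C_{\mathcal S}$ is the leading constant of $\mathcal S_{\gamma,b}$ and $U_a(K)=2\cdot3^a+16^a\sum_{j=1}^{\lfloor\log_2K\rfloor}(1+H_{2^{j+1}})^a2^{j(1-3a/2)}$. For $t=0,\dots,K$: set the warm start $w_0=x_0$, $w_1=\widehat y_0$, $w_t=\Pi_{\mathcal X}(2\widehat y_{t-1}-\widehat y_{t-2})$ for $t\ge2$ (Euclidean projection); let $G_t(z)=F(z)+(z-x_t)/\eta$; obtain $(\widehat y_t,n_t,G_t(\widehat y_t))$ from $\mathcal S_{\gamma,b}(G_t,w_t,1/\eta,\delta)$; if the active cap is exhausted, return failure immediately; if $t<K$ set $x_{t+1}=\frac{x_0+(t+1)\widehat y_t}{t+2}$. Finally compute $F(\widehat y_K)=G_K(\widehat y_K)-(\widehat y_K-x_K)/\eta$; if $\|F(\widehat y_K)+n_K\|\le\varepsilon$ return $(\widehat y_K,n_K,F(\widehat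 y_K))$, otherwise return failure. *)

theory Defs
  imports "HOL-Analysis.Analysis"
begin

section \<open>Derivative tensors and the operator class\<close>

text \<open>\<open>nderiv F [h\<^sub>1, \<dots>, h\<^sub>k] x\<close> is the vector \<open>D\<^sup>kF(x)[h\<^sub>1, \<dots>, h\<^sub>k]\<close>.  The order of the
  derivative is the length of the list of directions.\<close>

primrec nderiv :: "('a::real_normed_vector \<Rightarrow> 'b::real_normed_vector) \<Rightarrow> 'a list \<Rightarrow> 'a \<Rightarrow> 'b" where
  "nderiv F [] = F"
| "nderiv F (h # hs) = (\<lambda>x. frechet_derivative (nderiv F hs) (at x) h)"

text \<open>In finite dimension, differentiability and continuity of a tensor-valued map can be tested
  after evaluation at fixed directions.\<close>

definition Ck_on :: "nat \<Rightarrow> 'a set \<Rightarrow> ('a::euclidean_space \<Rightarrow> 'a) \<Rightarrow> bool" where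
  "Ck_on k U F \<longleftrightarrow>
     (\<forall>hs. length hs < k \<longrightarrow> (\<forall>x\<in>U. nderiv F hs differentiable (at x))) \<and>
     (\<forall>hs. length hs \<le> k \<longrightarrow> continuous_on U (nderiv F hs))"

definition mop_norm :: "nat \<Rightarrow> ('a::euclidean_space list \<Rightarrow> 'a) \<Rightarrow> real" where
  "mop_norm k A = (SUP hs\<in>{hs. length hs = k \<and> (\<forall>h\<in>set hs. norm h \<le> 1)}. norm (A hs))"

definition monotone_operator_on :: "'a set \<Rightarrow> ('a::euclidean_space \<Rightarrow> 'a) \<Rightarrow> bool" where
  "monotone_operator_on X F \<longleftrightarrow> (\<forall>x\<in>X. \<forall>y\<in>X. (F x - F y) \<bullet> (x - y) \<ge> 0)"

definition strongly_monotone_on :: "real \<Rightarrow> 'a set \<Rightarrow> ('a::euclidean_space \<Rightarrow> 'a) \<Rightarrow> bool" where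
  "strongly_monotone_on \<mu> X G \<longleftrightarrow>
     (\<forall>x\<in>X. \<forall>y\<in>X. (G x - G y) \<bullet> (x - y) \<ge> \<mu> * (norm (x - y))\<^sup>2)"

definition operator_class :: "nat \<Rightarrow> real \<Rightarrow> 'a set \<Rightarrow> ('a::euclidean_space \<Rightarrow> 'a) set" where
  "operator_class p L X =
     {F. (\<exists>U. open U \<and> X \<subseteq> U \<and> Ck_on (p - 1) U F) \<and>
         monotone_operator_on X F \<and>
         (\<forall>x\<in>X. \<forall>y\<in>X. mop_norm (p - 1) (\<lambda>hs. nderiv F hs x - nderiv F hs y) \<le> L * norm (x - y))}"

section \<open>Variational inequalities and certificates\<close>

definition normal_cone :: "'a set \<Rightarrow> 'a::euclidean_space \<Rightarrow> 'a set" where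
  "normal_cone X x = {n. \<forall>z\<in>X. n \<bullet> (z - x) \<le> 0}"

definition vi_solution :: "'a set \<Rightarrow> ('a::euclidean_space \<Rightarrow> 'a) \<Rightarrow> 'a \<Rightarrow> bool" where
  "vi_solution X F z \<longleftrightarrow> z \<in> X \<and> (\<exists>n\<in>normal_cone X z. F z + n = 0)"

text \<open>\<open>E\<close> is the set of points at which the operator has been evaluated.\<close>

definition certificate ::
  "'a set \<Rightarrow> ('a::euclidean_space \<Rightarrow> 'a) \<Rightarrow> real \<Rightarrow> 'a set \<Rightarrow> 'a \<times> 'a \<times> 'a \<Rightarrow> bool" where
  "certificate X F \<epsilon> E c \<longleftrightarrow>
     (case c of (x, n, v) \<Rightarrow>
        x \<in> X \<and> n \<in> normal_cone X x \<and> x \<in> E \<and> v = F x \<and> norm (v + n) \<le> \<epsilon>)"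

section \<open>Deterministic oracle algorithms\<close>

text \<open>A deterministic algorithm is a decision tree: it stops with an output, or asks a query of
  type \<open>'q\<close> and continues according to the answer of type \<open>'r\<close>.  All other computation is free.\<close>

datatype ('q, 'r, 'o) prog = Return 'o | Query 'q "'r \<Rightarrow> ('q, 'r, 'o) prog"

primrec result :: "('q, 'r, 'o) prog \<Rightarrow> ('q \<Rightarrow> 'r) \<Rightarrow> 'o" where
  "result (Return v) = (\<lambda>oracle. v)"
| "result (Query q k) = (\<lambda>oracle. result (k (oracle q)) oracle)"

primrec queries :: "('q, 'r, 'o) prog \<Rightarrow> ('q \<Rightarrow> 'r) \<Rightarrow> 'q list" where
  "queries (Return v) = (\<lambda>oracle. [])"
| "queries (Query q k) = (\<lambda>oracle. q # queries (k (oracle q)) oracle)"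

primrec bind_prog ::
  "('q, 'r, 'o) prog \<Rightarrow> ('o \<Rightarrow> ('q, 'r, 's) prog) \<Rightarrow> ('q, 'r, 's) prog" where
  "bind_prog (Return v) f = f v"
| "bind_prog (Query q k) f = Query q (\<lambda>r. bind_prog (k r) f)"

text \<open>\<open>capped P B\<close> charges the cap \<open>B\<close> before each query and fails (\<open>None\<close>) as soon as a query is
  requested with nothing left.\<close>

primrec capped :: "('q, 'r, 'o option) prog \<Rightarrow> nat \<Rightarrow> ('q, 'r, 'o option) prog" where
  "capped (Return v) = (\<lambda>B. Return v)"
| "capped (Query q k) =
     (\<lambda>B. case B of 0 \<Rightarrow> Return None | Suc B' \<Rightarrow> Query q (\<lambda>r. capped (k r) B'))"

text \<open>The jet \<open>(F(x), DF(x), \<dots>, D\<^sup>p\<^sup>-\<^sup>1F(x))\<close> is one function of a list of directions whose length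
  selects the order; beyond order \<open>p - 1\<close> it carries no information.\<close>

type_synonym 'a jet = "'a list \<Rightarrow> 'a"

definition jet :: "nat \<Rightarrow> ('a::euclidean_space \<Rightarrow> 'a) \<Rightarrow> 'a \<Rightarrow> 'a jet" where
  "jet p F x = (\<lambda>hs. if length hs < p then nderiv F hs x else 0)"

text \<open>\<open>affine_jet a c z J\<close> is the jet at \<open>z\<close> of \<open>F(z) + a z + c\<close>, computed from the jet \<open>J\<close> of \<open>F\<close>
  at \<open>z\<close>.  \<open>lift_affine a c P\<close> runs an algorithm \<open>P\<close> for that operator with the oracle of \<open>F\<close>, at one
  query to \<open>F\<close> per query of \<open>P\<close>.\<close>

definition affine_jet :: "real \<Rightarrow> 'a::euclidean_space \<Rightarrow> 'a \<Rightarrow> 'a jet \<Rightarrow> 'a jet" where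
  "affine_jet a c z J = (\<lambda>hs. case hs of
      [] \<Rightarrow> J [] + a *\<^sub>R z + c
    | [h] \<Rightarrow> J [h] + a *\<^sub>R h
    | _ \<Rightarrow> J hs)"

primrec lift_affine ::
  "real \<Rightarrow> 'a::euclidean_space \<Rightarrow> ('a, 'a jet, 'o) prog \<Rightarrow> ('a, 'a jet, 'o) prog" where
  "lift_affine a c (Return v) = Return v"
| "lift_affine a c (Query z k) = Query z (\<lambda>J. lift_affine a c (k (affine_jet a c z J)))"

section \<open>Residual and strong solvers\<close>

definition L_A :: "nat \<Rightarrow> real \<Rightarrow> real \<Rightarrow> real \<Rightarrow> real \<Rightarrow> real" where
  "L_A p L D R \<epsilon> = 1 + ln (2 + D / R + L * R ^ p / \<epsilon>)"

definition L_S :: "nat \<Rightarrow> real \<Rightarrow> real \<Rightarrow> real \<Rightarrow> real \<Rightarrow> real" where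
  "L_S p L D \<mu> \<delta> =
     1 + ln (2 + L * D ^ (p - 1) / \<mu> + L * D ^ p / \<delta> + \<mu> * D / \<delta>)"

definition Q_R :: "nat \<Rightarrow> real \<Rightarrow> real \<Rightarrow> real \<Rightarrow> real" where
  "Q_R p L R \<epsilon> = L * R ^ p / \<epsilon>"

type_synonym 'a cert = "'a \<times> 'a \<times> 'a"

text \<open>\<open>A x\<^sub>0 R \<epsilon>\<close> has access to \<open>F\<close> only through the oracle; \<open>None\<close> is a reported failure.  The budget
  holds for arbitrary oracle answers, and a successful output is a certificate even when the distance
  promise is false.\<close>

definition residual_solver ::
  "nat \<Rightarrow> real \<Rightarrow> real \<Rightarrow> 'a::euclidean_space set \<Rightarrow> real \<Rightarrow> real \<Rightarrow> real \<Rightarrow>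
   ('a \<Rightarrow> real \<Rightarrow> real \<Rightarrow> ('a, 'a jet, 'a cert option) prog) \<Rightarrow> bool" where
  "residual_solver p L D X C \<alpha> b A \<longleftrightarrow>
     (\<forall>x\<^sub>0 R \<epsilon>. x\<^sub>0 \<in> X \<and> 0 < R \<and> R \<le> D \<and> 0 < \<epsilon> \<longrightarrow>
        (\<exists>B::nat.
           real B \<le> C * (1 + Q_R p L R \<epsilon> powr \<alpha>) * L_A p L D R \<epsilon> powr b \<and>
           (\<forall>oracle. length (queries (A x\<^sub>0 R \<epsilon>) oracle) \<le> B)) \<and>
        (\<forall>F\<in>operator_class p L X.
           let qs = set (queries (A x\<^sub>0 R \<epsilon>) (jet p F)); out = result (A x\<^sub>0 R \<epsilon>) (jet p F)
           in qs \<subseteq> X \<and>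
              (\<forall>c. out = Some c \<longrightarrow> certificate X F \<epsilon> qs c) \<and>
              ((\<exists>z. vi_solution X F z \<and> norm (x\<^sub>0 - z) \<le> R) \<longrightarrow> out \<noteq> None)))"

definition strong_solver ::
  "nat \<Rightarrow> real \<Rightarrow> real \<Rightarrow> 'a::euclidean_space set \<Rightarrow> real \<Rightarrow> real \<Rightarrow> real \<Rightarrow>
   ('a \<Rightarrow> real \<Rightarrow> real \<Rightarrow> ('a, 'a jet, 'a cert) prog) \<Rightarrow> bool" where
  "strong_solver p L D X C \<gamma> b S \<longleftrightarrow>
     (\<forall>G w \<mu> \<delta>. G \<in> operator_class p L X \<and> strongly_monotone_on \<mu> X G \<and>
                w \<in> X \<and> 0 < \<mu> \<and> 0 < \<delta> \<longrightarrow>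
        (let qs = queries (S w \<mu> \<delta>) (jet p G)
         in set qs \<subseteq> X \<and>
            certificate X G \<delta> (set qs) (result (S w \<mu> \<delta>) (jet p G)) \<and>
            (\<forall>z. vi_solution X G z \<longrightarrow>
               real (length qs) \<le>
                 C * (1 + (L * norm (w - z) ^ (p - 1) / \<mu>) powr \<gamma>) * L_S p L D \<mu> \<delta> powr b)))"

section \<open>The extrapolated inexact Halpern construction\<close>

definition U_sum :: "real \<Rightarrow> nat \<Rightarrow> real" where
  "U_sum a K = 2 * 3 powr a +
     16 powr a * (\<Sum>j = 1..nat \<lfloor>log 2 (real K)\<rfloor>.
        (1 + harm (2 ^ (j + 1))) powr a * 2 powr (real j * (1 - 3 * a / 2)))"

definition inner_error :: "real \<Rightarrow> nat \<Rightarrow> real" where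
  "inner_error R K = R / (real K + 2) ^ 4"

definition prox_step :: "real \<Rightarrow> real \<Rightarrow> nat \<Rightarrow> real" where
  "prox_step R \<epsilon> K = 8 * R * (1 + harm (K + 1)) / (\<epsilon> * (real K + 1))"

definition query_cap ::
  "nat \<Rightarrow> real \<Rightarrow> real \<Rightarrow> real \<Rightarrow> real \<Rightarrow> real \<Rightarrow> real \<Rightarrow> real \<Rightarrow> nat \<Rightarrow> nat" where
  "query_cap p L D C\<^sub>S \<gamma> b R \<epsilon> K =
     (let e = inner_error R K; \<eta> = prox_step R \<epsilon> K; a = (real p - 1) * \<gamma>
      in nat \<lceil>C\<^sub>S * L_S p L D (1 / \<eta>) (e / \<eta>) powr b *
              (real K + 1 + (\<eta> * L) powr \<gamma> * R powr a * U_sum a K)\<rceil> + 1)"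

text \<open>The state before outer step \<open>t\<close> is the list \<open>[y\<^sub>t\<^sub>-\<^sub>1, \<dots>, y\<^sub>0]\<close> of the inner outputs so far, most
  recent first, so \<open>t\<close> is its length.\<close>

definition halpern_point :: "'a::euclidean_space \<Rightarrow> 'a list \<Rightarrow> 'a" where
  "halpern_point x\<^sub>0 ys = (case ys of
      [] \<Rightarrow> x\<^sub>0
    | y # _ \<Rightarrow> (x\<^sub>0 + real (length ys) *\<^sub>R y) /\<^sub>R (real (length ys) + 1))"

definition warm_start :: "'a set \<Rightarrow> 'a::euclidean_space \<Rightarrow> 'a list \<Rightarrow> 'a" where
  "warm_start X x\<^sub>0 ys = (case ys of
      [] \<Rightarrow> x\<^sub>0
    | [y] \<Rightarrow> y
    | y # y' # _ \<Rightarrow> closest_point X (2 *\<^sub>R y - y'))"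

text \<open>The strong solver applied to \<open>G\<^sub>t(z) = F(z) + (z - x\<^sub>t) / \<eta>\<close>, run with the oracle of \<open>F\<close>.\<close>

definition inner_call ::
  "'a set \<Rightarrow> ('a::euclidean_space \<Rightarrow> real \<Rightarrow> real \<Rightarrow> ('a, 'a jet, 'a cert) prog) \<Rightarrow>
   'a \<Rightarrow> real \<Rightarrow> real \<Rightarrow> 'a list \<Rightarrow> ('a, 'a jet, 'a cert) prog" where
  "inner_call X S x\<^sub>0 \<eta> \<delta> ys =
     lift_affine (1 / \<eta>) (- (halpern_point x\<^sub>0 ys /\<^sub>R \<eta>)) (S (warm_start X x\<^sub>0 ys) (1 / \<eta>) \<delta>)"

text \<open>The first numeric argument of \<open>halpern_loop\<close> is \<open>K - t\<close>.\<close>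

primrec halpern_loop ::
  "nat \<Rightarrow> 'a set \<Rightarrow> ('a::euclidean_space \<Rightarrow> real \<Rightarrow> real \<Rightarrow> ('a, 'a jet, 'a cert) prog) \<Rightarrow>
   'a \<Rightarrow> real \<Rightarrow> real \<Rightarrow> real \<Rightarrow> 'a list \<Rightarrow> ('a, 'a jet, 'a cert option) prog" where
  "halpern_loop 0 X S x\<^sub>0 \<epsilon> \<eta> \<delta> ys =
     bind_prog (inner_call X S x\<^sub>0 \<eta> \<delta> ys)
       (\<lambda>(y, n, g). let v = g - (y - halpern_point x\<^sub>0 ys) /\<^sub>R \<eta>
          in Return (if norm (v + n) \<le> \<epsilon> then Some (y, n, v) else None))"
| "halpern_loop (Suc m) X S x\<^sub>0 \<epsilon> \<eta> \<delta> ys =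
     bind_prog (inner_call X S x\<^sub>0 \<eta> \<delta> ys)
       (\<lambda>(y, n, g). halpern_loop m X S x\<^sub>0 \<epsilon> \<eta> \<delta> (y # ys))"

definition halpern ::
  "nat \<Rightarrow> real \<Rightarrow> real \<Rightarrow> 'a set \<Rightarrow> real \<Rightarrow> real \<Rightarrow> real \<Rightarrow>
   ('a::euclidean_space \<Rightarrow> real \<Rightarrow> real \<Rightarrow> ('a, 'a jet, 'a cert) prog) \<Rightarrow>
   nat \<Rightarrow> 'a \<Rightarrow> real \<Rightarrow> real \<Rightarrow> ('a, 'a jet, 'a cert option) prog" where
  "halpern p L D X C\<^sub>S \<gamma> b S K x\<^sub>0 R \<epsilon> =
     (let \<eta> = prox_step R \<epsilon> K; \<delta> = inner_error R K / \<eta>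
      in capped (halpern_loop K X S x\<^sub>0 \<epsilon> \<eta> \<delta> []) (query_cap p L D C\<^sub>S \<gamma> b R \<epsilon> K))"

text \<open>A crude admissible leading constant for the resulting residual solver.  The dimension is a type
  and cannot be quantified after an existentially quantified constant, so independence of the
  dimension (and of the domain, \<open>L\<close>, \<open>D\<close>, \<open>x\<^sub>0\<close>, \<open>R\<close>, \<open>\<epsilon>\<close>) is made visible by an explicit formula in
  \<open>p\<close>, the exponent \<open>b\<close> and the leading constant of the strong solver only.\<close>

definition residual_const :: "nat \<Rightarrow> real \<Rightarrow> real \<Rightarrow> real" where
  "residual_const p b C\<^sub>S = 1000000 * (1 + C\<^sub>S) * (real p + 11) powr \<bar>b\<bar>"

end

theory Submission
  imports Defs
begin

text \<open>Let \<open>J\<close> be the resolvent of \<open>\<eta> (F + N\<^sub>X)\<close>; the inner calls compute \<open>J x\<^sub>t\<close> up to an error \<open>e\<close>.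
  The rescaled increments \<open>t \<parallel>x\<^sub>t - x\<^sub>t\<^sub>-\<^sub>1\<parallel>\<close> of the Halpern iteration grow by \<open>O(R/t)\<close> per step only,
  hence stay \<open>O(R log t)\<close>, which bounds the final residual.  Since \<open>J\<close> is firmly nonexpansive, the
  squared increments moreover lose \<open>t\<^sup>2 \<parallel>\<Delta>(x - Jx)\<^sub>t\<parallel>\<^sup>2\<close> in every step; summed over a dyadic block this
  makes the second differences of \<open>J x\<^sub>t\<close>, and so the warm start distances, of size \<open>R t\<^sup>-\<^sup>3\<^sup>/\<^sup>2\<close>
  up to logarithms in the quadratic mean.  For \<open>2/3 \<le> a \<le> 2\<close> their \<open>a\<close>-th powers then sum to \<open>R\<^sup>a\<close> times
  a power of the logarithm, so the total cost is \<open>K + (\<eta> L)\<^sup>\<gamma> R\<^sup>a\<close> up to logarithms, and the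
  choice of \<open>K\<close> balances the two terms.\<close>

section \<open>Running oracle programs and the operator class\<close>

text \<open>An inner call costs the a-th power of a warm start distance that the solver is never
  told. No single distance need be small; only the sum of these powers counts, so square-summable
  control of second differences suffices, and the warm start extrapolates linearly in order to be
  measured by a second difference. The bound \<open>a \<le> 2\<close> lets concavity pass from
  squares to a-th powers. At \<open>3 / 2 * a = 1\<close> all dyadic blocks contribute alike, and
  their number is lost as a logarithm. This explains the exponent b + 4: one logarithm from \<eta>,
  two from (1 + H)^a, one from the block count. The fourth power in \<open>inner_error\<close> keeps
  errors accumulated to order e K^2 a small fraction of R. The query bound must survive false
  promises and arbitrary answers; it comes from truncation alone, so the analysis only has to show
  that under the promise the cap never interferes.\<close>

lemma result_bind_prog:
  "result (bind_prog P f) \<omega> = result (f (result P \<omega>)) \<omega>"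
  by (induction P) auto

lemma queries_bind_prog:
  "queries (bind_prog P f) \<omega> = queries P \<omega> @ queries (f (result P \<omega>)) \<omega>"
  by (induction P) auto

lemma queries_capped: "queries (capped P B) \<omega> = take B (queries P \<omega>)"
  by (induction P arbitrary: B) (auto split: nat.split)

lemma result_capped:
  "result (capped P B) \<omega> = (if length (queries P \<omega>) \<le> B then result P \<omega> else None)"
  by (induction P arbitrary: B) (auto split: nat.split)

text \<open>Agreement is asked only at points actually queried: smoothness of F is known only near
  X, so \<open>jet_affine\<close> can relate the two oracles only there.\<close>

lemma lift_affine_run:
  assumes "\<And>z. z \<in> set (queries P \<omega>') \<Longrightarrow> \<omega>' z = affine_jet a c z (\<omega> z)"
  shows "queries (lift_affine a c P) \<omega> = queries P \<omega>'"
    and "result (lift_affine a c P) \<omega> = result P \<omega>'"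
  using assms by (induction P) auto

section \<open>Affine perturbations of jets and of the operator class\<close>

lemma nderiv_affine:
  fixes F :: "'a::euclidean_space \<Rightarrow> 'a"
  assumes "open U" "Ck_on k U F" "length hs \<le> k" "x \<in> U"
  shows "nderiv (\<lambda>z. F z + a *\<^sub>R z + c) hs x = affine_jet a c x (\<lambda>hs. nderiv F hs x) hs"
  using assms(3,4)
proof (induction hs arbitrary: x)
  case Nil
  then show ?case by (simp add: affine_jet_def)
next
  case (Cons h hs)
  let ?G = "\<lambda>z. F z + a *\<^sub>R z + c"
  have diff: "(nderiv F hs has_derivative frechet_derivative (nderiv F hs) (at x)) (at x)"
    using assms(2) Cons.prems unfolding Ck_on_def
    by (metis frechet_derivative_works length_Cons Suc_le_eq)
  have eq: "nderiv ?G hs y = affine_jet a c y (\<lambda>hs. nderiv F hs y) hs" if "y \<in> U" for y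
    using Cons.IH Cons.prems that by simp
  show ?case
  proof (cases hs)
    case Nil
    have "(?G has_derivative (\<lambda>h. frechet_derivative F (at x) h + a *\<^sub>R h)) (at x)"
      using diff Nil by (auto intro!: derivative_eq_intros)
    then show ?thesis
      using Nil by (simp add: affine_jet_def frechet_derivative_at[symmetric])
  next
    case (Cons h' hs')
    have "((\<lambda>y. affine_jet a c y (\<lambda>hs. nderiv F hs y) hs) has_derivative
        frechet_derivative (nderiv F hs) (at x)) (at x)"
    proof (cases hs')
      case Nil
      have "((\<lambda>y. nderiv F hs y + a *\<^sub>R h') has_derivative
          frechet_derivative (nderiv F hs) (at x)) (at x)"
        using diff by (auto intro!: derivative_eq_intros)
      then show ?thesis using Cons Nil by (simp add: affine_jet_def)
    next
      case (Cons h'' hs'')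
      then show ?thesis using \<open>hs = h' # hs'\<close> diff by (simp add: affine_jet_def)
    qed
    \<comment> \<open>The formula for the lower order holds only on U. Openness of U makes this
      enough to differentiate it at x; hence the induction runs over all points of U at
      once.\<close>
    then have "(nderiv ?G hs has_derivative frechet_derivative (nderiv F hs) (at x)) (at x)"
      by (rule has_derivative_transform_within_open[OF _ assms(1) \<open>x \<in> U\<close>])
         (use eq in auto)
    then show ?thesis
      using Cons by (simp add: affine_jet_def frechet_derivative_at[symmetric])
  qed
qed

text \<open>\<open>p \<ge> 2\<close> makes order one part of the jet; otherwise
  \<open>affine_jet\<close> would add a multiple of the direction to an entry that
  \<open>jet\<close> truncates to 0.\<close>

lemma jet_affine:
  fixes F :: "'a::euclidean_space \<Rightarrow> 'a"
  assumes "p \<ge> 2" "open U" "Ck_on (p - 1) U F" "x \<in> U"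
  shows "jet p (\<lambda>z. F z + a *\<^sub>R z + c) x = affine_jet a c x (jet p F x)"
proof
  fix hs :: "'a list"
  have "length hs \<le> p - 1" if "length hs < p" using that by simp
  then show "jet p (\<lambda>z. F z + a *\<^sub>R z + c) x hs = affine_jet a c x (jet p F x) hs"
    using nderiv_affine[OF assms(2,3) _ assms(4), of hs a c] assms(1)
    by (auto simp: jet_def affine_jet_def split: list.splits)
qed

lemma Ck_on_affine:
  fixes F :: "'a::euclidean_space \<Rightarrow> 'a"
  assumes "open U" "Ck_on k U F"
  shows "Ck_on k U (\<lambda>z. F z + a *\<^sub>R z + c)"
  unfolding Ck_on_def
proof (intro conjI allI impI ballI)
  fix hs :: "'a list"
  let ?G = "\<lambda>z. F z + a *\<^sub>R z + c"
  let ?J = "\<lambda>y. affine_jet a c y (\<lambda>hs. nderiv F hs y) hs"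
  {
    fix x assume "length hs < k" "x \<in> U"
    then have "nderiv F hs differentiable (at x)" using assms(2) by (auto simp: Ck_on_def)
    then have "?J differentiable (at x)"
      by (cases hs rule: list.exhaust; cases "tl hs" rule: list.exhaust)
         (auto simp: affine_jet_def)
    moreover have "?J y = nderiv ?G hs y" if "y \<in> U" for y
      using nderiv_affine[OF assms _ that, of hs a c] \<open>length hs < k\<close> by simp
    ultimately show "nderiv ?G hs differentiable (at x)"
      using assms(1) \<open>x \<in> U\<close> unfolding differentiable_def
      by (metis (no_types, lifting) has_derivative_transform_within_open)
  }
  assume le: "length hs \<le> k"
  then have "continuous_on U (nderiv F hs)" using assms(2) by (auto simp: Ck_on_def)
  then have "continuous_on U ?J"
    by (cases hs rule: list.exhaust; cases "tl hs" rule: list.exhaust)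
       (auto simp: affine_jet_def intro!: continuous_intros)
  then show "continuous_on U (nderiv ?G hs)"
    using nderiv_affine[OF assms le, of _ a c] by (simp cong: continuous_on_cong)
qed

lemma strongly_monotone_on_affine:
  assumes "monotone_operator_on X F"
  shows "strongly_monotone_on a X (\<lambda>z. F z + a *\<^sub>R z + c)"
  unfolding strongly_monotone_on_def
proof (intro ballI)
  fix x y assume "x \<in> X" "y \<in> X"
  then have "(F x - F y) \<bullet> (x - y) \<ge> 0" using assms by (simp add: monotone_operator_on_def)
  moreover have "(F x + a *\<^sub>R x + c - (F y + a *\<^sub>R y + c)) \<bullet> (x - y)
      = (F x - F y) \<bullet> (x - y) + a * (norm (x - y))\<^sup>2"
    by (simp add: power2_norm_eq_inner algebra_simps)
  ultimately show "(F x + a *\<^sub>R x + c - (F y + a *\<^sub>R y + c)) \<bullet> (x - y) \<ge> a * (norm (x - y))\<^sup>2"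
    by simp
qed

text \<open>The Lipschitz condition concerns only the top order p - 1, which is at least 1. There
  the affine part contributes a constant tensor if p = 2 and nothing if p > 2, so it cancels in
  differences and L is unchanged.\<close>

lemma operator_class_affine:
  fixes F :: "'a::euclidean_space \<Rightarrow> 'a"
  assumes "p \<ge> 2" "F \<in> operator_class p L X" "a \<ge> 0"
  shows "(\<lambda>z. F z + a *\<^sub>R z + c) \<in> operator_class p L X"
proof -
  obtain U where U: "open U" "X \<subseteq> U" "Ck_on (p - 1) U F"
    using assms(2) by (auto simp: operator_class_def)
  let ?G = "\<lambda>z. F z + a *\<^sub>R z + c"
  have "monotone_operator_on X F" using assms(2) by (simp add: operator_class_def)
  then have "strongly_monotone_on a X ?G" by (rule strongly_monotone_on_affine)
  then have "monotone_operator_on X ?G"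
    using assms(3) unfolding strongly_monotone_on_def monotone_operator_on_def
    by (meson mult_nonneg_nonneg order_trans zero_le_power2)
  moreover have "mop_norm (p - 1) (\<lambda>hs. nderiv ?G hs x - nderiv ?G hs y)
      = mop_norm (p - 1) (\<lambda>hs. nderiv F hs x - nderiv F hs y)" if "x \<in> X" "y \<in> X" for x y
  proof -
    have "nderiv ?G hs x - nderiv ?G hs y = nderiv F hs x - nderiv F hs y"
      if "length hs = p - 1" for hs
    proof -
      have "hs \<noteq> []" using that assms(1) by auto
      then show ?thesis
        using nderiv_affine[OF U(1,3), of hs _ a c] that \<open>x \<in> X\<close> \<open>y \<in> X\<close> U(2)
        by (auto simp: affine_jet_def subset_iff split: list.splits)
    qed
    then show ?thesis unfolding mop_norm_def by (intro SUP_cong) auto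
  qed
  ultimately show ?thesis
    using assms(2) U Ck_on_affine[OF U(1,3)] by (auto simp: operator_class_def)
qed

text \<open>With \<open>operator_class_affine\<close> this puts the identity into the class, the
  test operator of \<open>strong_solver_constants\<close>.\<close>

lemma zero_in_operator_class:
  assumes "L \<ge> 0"
  shows "(\<lambda>_. 0) \<in> operator_class p L (X :: 'a::euclidean_space set)"
proof -
  have 0: "nderiv (\<lambda>_. 0 :: 'a) hs = (\<lambda>_. 0)" for hs :: "'a list"
    by (induction hs) (auto simp: frechet_derivative_const)
  \<comment> \<open>Zero directions are admissible, so the supremum in \<open>mop_norm\<close>
    ranges over a nonempty set and the constant 0 has supremum 0.\<close>
  have ne: "replicate k 0 \<in> {hs. length hs = k \<and> (\<forall>h\<in>set hs. norm (h::'a) \<le> 1)}" for k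
    by (auto simp: set_replicate_conv_if)
  have "mop_norm k (\<lambda>_. 0 :: 'a) = 0" for k
    unfolding mop_norm_def using ne[of k] by (subst cSUP_const) (blast, simp)
  then show ?thesis
    using assms by (auto simp: operator_class_def Ck_on_def 0 monotone_operator_on_def)
qed

text \<open>Brouwer's theorem for the projected step from z to the projection of z - G z. At a fixed
  point, the obtuse angle property of the projection says that - G z is normal to X.\<close>

lemma vi_solution_exists:
  fixes X :: "'a::euclidean_space set"
  assumes "X \<noteq> {}" "compact X" "convex X" "continuous_on X G"
  obtains z where "vi_solution X G z"
proof -
  have cl: "closed X" using assms(2) by (rule compact_imp_closed)
  let ?f = "\<lambda>z. closest_point X (z - G z)"
  have "continuous_on X ?f"
    using assms cl
    by (intro continuous_on_compose2[OF continuous_on_closest_point[of X UNIV]])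
       (auto intro!: continuous_intros)
  moreover have "?f \<in> X \<rightarrow> X"
    using closest_point_in_set[OF cl assms(1)] by auto
  ultimately obtain z where z: "z \<in> X" "?f z = z"
    using brouwer[OF assms(2,3,1), of ?f] by blast
  have "- G z \<in> normal_cone X z"
    unfolding normal_cone_def
  proof (intro CollectI ballI)
    fix y assume "y \<in> X"
    then have "(z - G z - ?f z) \<bullet> (y - ?f z) \<le> 0"
      using closest_point_dot[OF assms(3) cl] by blast
    then show "- G z \<bullet> (y - z) \<le> 0" using z(2) by simp
  qed
  then show thesis using z(1) by (intro that[of z]) (auto simp: vi_solution_def intro!: bexI)
qed

lemma operator_class_continuous:
  assumes "F \<in> operator_class p L X"
  shows "continuous_on X F"
proof -
  obtain U where "X \<subseteq> U" "Ck_on (p - 1) U F"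
    using assms by (auto simp: operator_class_def)
  moreover then have "continuous_on U (nderiv F [])"
    unfolding Ck_on_def by (metis le0 list.size(3))
  ultimately show ?thesis using continuous_on_subset by fastforce
qed

section \<open>The inexact Halpern iteration\<close>

text \<open>\<open>y t\<close> plays the resolvent value of \<open>x t\<close>, \<open>yh t\<close>
  its computed approximation, \<open>zs\<close> a fixed point of the resolvent. The sequences extend
  to all indices, so \<open>x (Suc K)\<close>, which the algorithm never computes, is available to
  the analysis.\<close>

locale inexact_halpern =
  fixes x y yh :: "nat \<Rightarrow> 'a::real_inner" and zs :: 'a and R e :: real and K :: nat
  assumes x_Suc: "x (Suc t) = (x 0 + (real t + 1) *\<^sub>R yh t) /\<^sub>R (real t + 2)"
    and err: "norm (yh t - y t) \<le> e"
    and firm: "(norm (y s - y t))\<^sup>2 + (norm ((x s - y s) - (x t - y t)))\<^sup>2 \<le> (norm (x s - x t))\<^sup>2"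
    and fejer: "norm (y t - zs) \<le> norm (x t - zs)"
    and start: "norm (x 0 - zs) \<le> R"
    and R_pos: "R > 0" and K_ge: "K \<ge> 2"
    and e_def: "e = inner_error R K"
begin

section \<open>A priori bounds and accumulated errors\<close>

lemma scaled_x_Suc: "(real t + 2) *\<^sub>R x (Suc t) = x 0 + (real t + 1) *\<^sub>R yh t"
  unfolding x_Suc by (simp add: add_eq_0_iff)

lemma e_pos: "e > 0"
  using R_pos by (simp add: e_def inner_error_def)

lemma e_K_plus_2: "e * (real K + 2)\<^sup>2 \<le> R / 16"
proof -
  have "16 \<le> (real K + 2)\<^sup>2" using K_ge power_mono[of 4 "real K + 2" 2] by simp
  moreover have "e * (real K + 2)\<^sup>2 = R / (real K + 2)\<^sup>2"
    by (simp add: e_def inner_error_def power2_eq_square power4_eq_xxxx)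
  moreover have "R / (real K + 2)\<^sup>2 \<le> R / 16"
    by (rule divide_left_mono) (use R_pos calculation in auto)
  ultimately show ?thesis by simp
qed

lemma e_sq: assumes "t \<le> K" shows "e * (real t)\<^sup>2 \<le> R / 64"
proof -
  have k: "real K \<ge> 2" using K_ge by simp
  \<comment> \<open>AM-GM in the form 8 K \<le> (K + 2)^2; its square matches the fourth power in
    \<open>inner_error\<close> and produces the factor 64.\<close>
  have "0 \<le> (real K - 2)\<^sup>2" by simp
  then have "8 * real K \<le> (real K + 2)\<^sup>2" by (simp add: power2_eq_square algebra_simps)
  then have "(8 * real K)\<^sup>2 \<le> ((real K + 2)\<^sup>2)\<^sup>2" by (intro power_mono) auto
  then have "64 * (real K)\<^sup>2 \<le> (real K + 2) ^ 4" by (simp add: power_mult_distrib flip: power_mult)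
  moreover have "(real K + 2) ^ 4 > 0" by simp
  ultimately have "R * (64 * (real K)\<^sup>2) / (real K + 2) ^ 4 \<le> R"
    using R_pos by (simp add: field_simps)
  then have "e * (real K)\<^sup>2 \<le> R / 64"
    by (simp add: e_def inner_error_def mult_ac)
  moreover have "e * (real t)\<^sup>2 \<le> e * (real K)\<^sup>2"
    using assms e_pos by (intro mult_left_mono power_mono) auto
  ultimately show ?thesis by linarith
qed

text \<open>The next iterate averages the anchor and \<open>yh t\<close> with weights 1 and t + 1.
  The anchor is within R of \<open>zs\<close>, and by \<open>fejer\<close> and \<open>err\<close> a
  step adds at most e, so errors add up without compounding.\<close>

lemma norm_x_diff_zs: "norm (x t - zs) \<le> R + e * real t"
proof (induction t)
  case 0
  then show ?case using start by simp
next
  case (Suc t)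
  have "norm (yh t - zs) \<le> norm (yh t - y t) + norm (y t - zs)" by norm
  then have y: "norm (yh t - zs) \<le> R + e * (real t + 1)"
    using Suc err[of t] fejer[of t] by (simp add: algebra_simps)
  have "(real t + 2) *\<^sub>R (x (Suc t) - zs) = (x 0 - zs) + (real t + 1) *\<^sub>R (yh t - zs)"
    unfolding scaleR_right_diff_distrib[of "real t + 2"] scaled_x_Suc
    by (simp add: algebra_simps scaleR_2)
  then have "(real t + 2) * norm (x (Suc t) - zs) = norm ((x 0 - zs) + (real t + 1) *\<^sub>R (yh t - zs))"
    by (metis abs_of_nonneg add_nonneg_nonneg norm_scaleR of_nat_0_le_iff zero_le_numeral)
  also have "\<dots> \<le> norm (x 0 - zs) + (real t + 1) * norm (yh t - zs)"
    by (rule order_trans[OF norm_triangle_ineq]) simp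
  also have "\<dots> \<le> R + (real t + 1) * (R + e * (real t + 1))"
    using start y by (intro add_mono mult_left_mono) auto
  also have "\<dots> \<le> (real t + 2) * (R + e * (real t + 1))"
    using e_pos by (simp add: algebra_simps)
  finally show ?case by (simp add: add_ac)
qed

text \<open>The detour through \<open>zs\<close> gives 2 R and the errors at most R/16; 9/4 is a
  rounded value.\<close>

lemma norm_yh_diff_start:
  assumes "t \<le> K"
  shows "norm (yh t - x 0) \<le> 9 / 4 * R"
proof -
  have "norm (yh t - x 0) \<le> norm (yh t - y t) + norm (y t - zs) + norm (x 0 - zs)" by norm
  also have "\<dots> \<le> e + (R + e * real t) + R"
    using err[of t] fejer[of t] norm_x_diff_zs[of t] start by linarith
  also have "\<dots> \<le> 2 * R + e * (real K + 2)"
  proof -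
    have "e * real t \<le> e * real K" using assms e_pos by simp
    moreover have "e * (real K + 2) = e * real K + 2 * e" by (simp add: algebra_simps)
    ultimately show ?thesis using e_pos by linarith
  qed
  also have "e * (real K + 2) \<le> e * (real K + 2)\<^sup>2"
    using e_pos by (simp add: power2_eq_square)
  finally show ?thesis using e_K_plus_2 R_pos by linarith
qed

text \<open>The iterate at t + 1 is \<open>yh t\<close> moved towards the anchor with weight 1/(t +
  2). That weight drops by 1/((t + 1)(t + 2)) per step, which is the coefficient of the second
  term.\<close>

lemma x_diff_eq:
  assumes "t \<ge> 1"
  shows "x (Suc t) - x t = (real t / (real t + 1)) *\<^sub>R (yh t - yh (t - 1))
           + (1 / ((real t + 1) * (real t + 2))) *\<^sub>R (yh t - x 0)"
proof -
  obtain s where t: "t = Suc s" using assms by (cases t) auto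
  let ?a = "real s + 2" and ?b = "real s + 3"
  have nz: "?a \<noteq> 0" "?b \<noteq> 0" by auto
  have xt: "?a *\<^sub>R x t = x 0 + (real s + 1) *\<^sub>R yh s"
    using scaled_x_Suc[of s] t by simp
  have xt': "?b *\<^sub>R x (Suc t) = x 0 + ?a *\<^sub>R yh t"
    using scaled_x_Suc[of t] t by (simp add: add_ac)
  have "?a *\<^sub>R ?b *\<^sub>R (x (Suc t) - x t) = ?a *\<^sub>R ?b *\<^sub>R x (Suc t) - ?b *\<^sub>R ?a *\<^sub>R x t"
    by (simp add: scaleR_right_diff_distrib mult.commute)
  also have "\<dots> = (?a *\<^sub>R x 0 - ?b *\<^sub>R x 0) + ((?a * ?a) *\<^sub>R yh t - (?b * (real s + 1)) *\<^sub>R yh s)"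
    unfolding xt xt' scaleR_right_distrib by simp
  also have "?a *\<^sub>R x 0 - ?b *\<^sub>R x 0 = - x 0" by (simp flip: scaleR_diff_left)
  also have "?a * ?a = ?b * (real s + 1) + 1" by (simp add: algebra_simps)
  also have "- x 0 + ((?b * (real s + 1) + 1) *\<^sub>R yh t - (?b * (real s + 1)) *\<^sub>R yh s)
      = (?b * (real s + 1)) *\<^sub>R (yh t - yh s) + 1 *\<^sub>R (yh t - x 0)"
    unfolding scaleR_add_left scaleR_right_diff_distrib by simp
  also have "\<dots> = (?a * (?b * (real t / (real t + 1)))) *\<^sub>R (yh t - yh s)
        + (?a * (?b * (1 / ((real t + 1) * (real t + 2))))) *\<^sub>R (yh t - x 0)"
  proof -
    have "?a * (?b * (real t / (real t + 1))) = ?b * (real s + 1)"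
      using nz by (simp add: t field_simps)
    moreover have "?a * (?b * (1 / ((real t + 1) * (real t + 2)))) = 1"
      using nz by (simp add: t add_ac)
    ultimately show ?thesis by (simp only:)
  qed
  also have "\<dots> = ?a *\<^sub>R ?b *\<^sub>R ((real t / (real t + 1)) *\<^sub>R (yh t - yh (t - 1))
           + (1 / ((real t + 1) * (real t + 2))) *\<^sub>R (yh t - x 0))"
    unfolding scaleR_right_distrib by (simp add: t)
  finally show ?thesis using nz by (metis scaleR_left_imp_eq)
qed

text \<open>Multiplying \<open>x_diff_eq\<close> by t + 1 turns its factor t/(t + 1) into t, so
  increments scaled in this way obey a recursion with additive forcing only.\<close>

definition gap :: "nat \<Rightarrow> real" where
  "gap t = real t * norm (x t - x (t - 1))"

lemma gap_nonneg: "gap t \<ge> 0"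
  by (simp add: gap_def)

lemma norm_y_diff_le_gap: "real t * norm (y t - y (t - 1)) \<le> gap t"
proof -
  have "(norm (y t - y (t - 1)))\<^sup>2 \<le> (norm (x t - x (t - 1)))\<^sup>2"
    using firm[of t "t - 1"] by (smt (verit) zero_le_power2)
  then have "norm (y t - y (t - 1)) \<le> norm (x t - x (t - 1))" by simp
  then show ?thesis by (simp add: gap_def mult_left_mono)
qed

text \<open>The right-hand side keeps the increment of y instead of \<open>gap t\<close>: the loss
  between these two is what \<open>gap_decrease\<close> exploits.\<close>

lemma gap_Suc:
  assumes "t \<ge> 1" "t \<le> K"
  shows "gap (Suc t) \<le> real t * norm (y t - y (t - 1)) + 2 * e * real t + 9 / 4 * R / (real t + 2)"
proof -
  have nz: "real t + 1 \<noteq> 0" by simp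
  have cancel: "a * (c / a * A + 1 / (a * b) * B) = c * A + B / b"
    if "a \<noteq> 0" for a b c A B :: real
    using that by (simp add: distrib_left)
  have "gap (Suc t) = (real t + 1) * norm ((real t / (real t + 1)) *\<^sub>R (yh t - yh (t - 1))
           + (1 / ((real t + 1) * (real t + 2))) *\<^sub>R (yh t - x 0))"
    using x_diff_eq[OF assms(1)] by (simp add: gap_def add_ac)
  also have "\<dots> \<le> (real t + 1) * ((real t / (real t + 1)) * norm (yh t - yh (t - 1))
           + (1 / ((real t + 1) * (real t + 2))) * norm (yh t - x 0))"
    by (intro mult_left_mono order_trans[OF norm_triangle_ineq]) auto
  also have "\<dots> = real t * norm (yh t - yh (t - 1)) + norm (yh t - x 0) / (real t + 2)"
    by (rule cancel) (use nz in auto)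
  also have "\<dots> \<le> real t * (norm (y t - y (t - 1)) + 2 * e) + 9 / 4 * R / (real t + 2)"
  proof (intro add_mono mult_left_mono divide_right_mono)
    have "norm (yh t - yh (t - 1)) \<le> norm (y t - y (t - 1)) + norm (yh t - y t) + norm (yh (t - 1) - y (t - 1))"
      by norm
    then show "norm (yh t - yh (t - 1)) \<le> norm (y t - y (t - 1)) + 2 * e"
      using err[of t] err[of "t - 1"] by linarith
  qed (use norm_yh_diff_start[OF assms(2)] in auto)
  finally show ?thesis by (simp add: algebra_simps)
qed

text \<open>The forcing 9/4 R/(t + 2) sums to a harmonic number, and 2 e t sums to at most e t^2.
  The base value 1/2 is \<open>harm 2 - 1\<close>.\<close>

lemma gap_le:
  assumes "t \<ge> 1" "t \<le> K + 1"
  shows "gap t \<le> 9 / 4 * R * (harm (t + 1) - 1) + e * (real t)\<^sup>2"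
  using assms
proof (induction t rule: dec_induct)
  case base
  have "x 1 - x 0 = (1 / 2) *\<^sub>R (yh 0 - x 0)"
    using x_Suc[of 0] by (simp add: algebra_simps flip: scaleR_2)
  then have "gap 1 = norm (yh 0 - x 0) / 2" by (simp add: gap_def)
  also have "\<dots> \<le> 9 / 4 * R * (1 / 2)" using norm_yh_diff_start[of 0] by simp
  also have "(1::real) / 2 = harm (1 + 1) - 1" by (simp add: harm_expand numeral_2_eq_2 harm_Suc)
  finally show ?case using e_pos by simp
next
  case (step t)
  have harm_step: "harm (Suc t + 1) = (harm (t + 1) + 1 / (real t + 2) :: real)"
    by (simp add: harm_Suc[of "Suc t"] inverse_eq_divide add_ac)
  have "c * (H + 1 / q - 1) = c * (H - 1) + c / q" for c H q :: real
    by (simp add: algebra_simps)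
  from this[of "9 / 4 * R" "harm (t + 1)" "real t + 2"]
  have bound_step: "9 / 4 * R * (harm (Suc t + 1) - 1)
      = 9 / 4 * R * (harm (t + 1) - 1) + 9 / 4 * R / (real t + 2)"
    unfolding harm_step .
  have "gap (Suc t) \<le> gap t + 2 * e * real t + 9 / 4 * R / (real t + 2)"
    using gap_Suc[of t] norm_y_diff_le_gap[of t] step by simp
  also have "\<dots> \<le> 9 / 4 * R * (harm (t + 1) - 1) + e * (real t)\<^sup>2 + 2 * e * real t + 9 / 4 * R / (real t + 2)"
    using step by simp
  also have "\<dots> = 9 / 4 * R * (harm (Suc t + 1) - 1) + e * ((real t)\<^sup>2 + 2 * real t)"
  proof -
    have "e * ((real t)\<^sup>2 + 2 * real t) = e * (real t)\<^sup>2 + 2 * e * real t"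
      by (simp add: algebra_simps)
    then show ?thesis using bound_step by linarith
  qed
  also have "\<dots> \<le> 9 / 4 * R * (harm (Suc t + 1) - 1) + e * (real (Suc t))\<^sup>2"
    using e_pos by (intro add_left_mono mult_left_mono) (auto simp: power2_eq_square algebra_simps)
  finally show ?case .
qed

text \<open>The -1 in \<open>gap_le\<close> pays for the error term, as e t^2 \<le> R/64.\<close>

lemma gap_le_harm:
  assumes "t \<ge> 1" "t \<le> K" "t < n"
  shows "gap t \<le> 9 / 4 * R * harm n"
proof -
  have "9 / 4 * R * harm (t + 1) \<le> 9 / 4 * R * harm n"
    using assms R_pos by (intro mult_left_mono harm_mono) auto
  moreover have "9 / 4 * R * (harm (t + 1) - 1) = 9 / 4 * R * harm (t + 1) - 9 / 4 * R"
    unfolding right_diff_distrib by simp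
  ultimately show ?thesis
    using gap_le[of t] e_sq[of t] assms R_pos by linarith
qed

text \<open>Compare with the auxiliary iterate \<open>x (Suc K)\<close>: its distance to
  \<open>x K\<close> is a gap, and its distance to \<open>yh K\<close> is that of the anchor divided
  by K + 2. The right-hand side is \<epsilon> \<eta> for \<eta> = \<open>prox_step\<close>; the
  summand e accounts for the residual \<delta> = e/\<eta> of the last inner certificate.\<close>

lemma final_residual:
  "e + norm (x K - yh K) \<le> 8 * R * (1 + harm (K + 1)) / (real K + 1)"
proof -
  have harm_step: "harm (Suc K + 1) = (harm (K + 1) + 1 / (real K + 2) :: real)"
    by (simp add: harm_Suc[of "Suc K"] inverse_eq_divide add_ac)
  have eq: "(real K + 2) *\<^sub>R (x (Suc K) - yh K) = x 0 - yh K"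
    unfolding scaleR_right_diff_distrib[of "real K + 2"] scaled_x_Suc
    by (simp add: algebra_simps scaleR_2)
  have "(real K + 2) * norm (x (Suc K) - yh K) = norm (x 0 - yh K)"
    unfolding eq[symmetric] by simp
  then have 1: "(real K + 2) * norm (x (Suc K) - yh K) \<le> 9 / 4 * R"
    using norm_yh_diff_start[of K] by (simp add: norm_minus_commute)
  have "(real K + 1) * norm (x (Suc K) - yh K) \<le> (real K + 2) * norm (x (Suc K) - yh K)"
    by (intro mult_right_mono) auto
  with 1 have 1: "(real K + 1) * norm (x (Suc K) - yh K) \<le> 9 / 4 * R" by linarith
  have "(real K + 1) * norm (x K - yh K)
      \<le> (real K + 1) * (norm (x (Suc K) - x K) + norm (x (Suc K) - yh K))"
    by (intro mult_left_mono) (norm, simp)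
  also have "\<dots> = gap (Suc K) + (real K + 1) * norm (x (Suc K) - yh K)"
    by (simp add: gap_def algebra_simps)
  also have "\<dots> \<le> 9 / 4 * R * (harm (Suc K + 1) - 1) + e * (real (Suc K))\<^sup>2 + 9 / 4 * R"
    using gap_le[of "Suc K"] 1 by simp
  also have "\<dots> = 9 / 4 * R * harm (K + 1) + 9 / 4 * R / (real K + 2) + e * (real K + 1)\<^sup>2"
  proof -
    have "c * (H + 1 / q - 1) = c * H + c / q - c" for c H q :: real
      by (simp add: algebra_simps)
    from this[of "9 / 4 * R" "harm (K + 1)" "real K + 2"]
    have "9 / 4 * R * (harm (Suc K + 1) - 1)
        = 9 / 4 * R * harm (K + 1) + 9 / 4 * R / (real K + 2) - 9 / 4 * R"
      unfolding harm_step .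
    moreover have "e * (real (Suc K))\<^sup>2 = e * (real K + 1)\<^sup>2" by (simp add: add.commute)
    ultimately show ?thesis by linarith
  qed
  finally have 2: "(real K + 1) * norm (x K - yh K)
      \<le> 9 / 4 * R * harm (K + 1) + 9 / 4 * R / (real K + 2) + e * (real K + 1)\<^sup>2" .
  have 3: "9 / 4 * R / (real K + 2) \<le> 9 / 4 * R" using R_pos by (simp add: field_simps)
  have 4: "(real K + 1) * e + e * (real K + 1)\<^sup>2 \<le> e * (real K + 2)\<^sup>2"
    using e_pos by (simp add: power2_eq_square algebra_simps)
  have 5: "9 / 4 * R * harm (K + 1) \<le> 8 * R * harm (K + 1)"
    using R_pos harm_nonneg[of "K + 1", where ?'a = real] by (intro mult_right_mono) auto
  have "(real K + 1) * (e + norm (x K - yh K)) \<le> 8 * R * (1 + harm (K + 1))"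
    unfolding distrib_left using 2 3 4 5 e_K_plus_2 R_pos by linarith
  then show ?thesis by (simp add: field_simps)
qed

text \<open>The firmness defect \<open>\<parallel>\<Delta>(x - y)\<parallel>\<^sup>2\<close> that plain nonexpansiveness discards telescopes over a dyadic
  block; this is what makes the second differences of \<open>y\<close> small on average.\<close>

lemma gap_decrease:
  assumes T: "T \<ge> 2" "T \<le> t" "t < 2 * T" "t \<le> K"
  shows "(real T)\<^sup>2 * (norm ((x t - y t) - (x (t - 1) - y (t - 1))))\<^sup>2
     \<le> (gap t)\<^sup>2 - (gap (Suc t))\<^sup>2 + 7 * R\<^sup>2 * (harm (2 * T))\<^sup>2 / real T"
proof -
  define h :: real where "h = harm (2 * T)"
  define V where "V = norm ((x t - y t) - (x (t - 1) - y (t - 1)))"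
  define E where "E = norm (y t - y (t - 1))"
  define s where "s = 2 * e * real t + 9 / 4 * R / (real t + 2)"
  \<comment> \<open>\<open>harm 4\<close> is 25/12. With h \<ge> 2, terms of order 1 and h are
    absorbed into h^2 below (45/8 + 25/32 < 7).\<close>
  have "(2::real) \<le> harm 4" by (simp add: harm_expand)
  also have "harm 4 \<le> h" unfolding h_def using T by (intro harm_mono) auto
  finally have h: "h \<ge> 2" .
  have et: "e * (real t)\<^sup>2 \<le> R / 64" using e_sq T by auto
  have g: "gap t \<le> 9 / 4 * R * h" unfolding h_def using T by (intro gap_le_harm) auto
  have s0: "s \<ge> 0" using e_pos R_pos by (simp add: s_def)
  have "s * real T = 2 * (e * (real t * real T)) + 9 / 4 * R * (real T / (real t + 2))"
    by (simp add: s_def algebra_simps)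
  also have "\<dots> \<le> 2 * (e * (real t)\<^sup>2) + 9 / 4 * R * 1"
    using T e_pos R_pos by (intro add_mono mult_left_mono) (auto simp: power2_eq_square mult_left_mono)
  also have "\<dots> \<le> 5 / 2 * R" using et R_pos by linarith
  finally have sT: "s * real T \<le> 5 / 2 * R" .
  then have s: "s \<le> 5 / 2 * R / real T" using T by (simp add: field_simps)
  have "gap (Suc t) \<le> real t * E + s" using gap_Suc[of t] T by (simp add: E_def s_def)
  then have "(gap (Suc t))\<^sup>2 \<le> (real t * E + s)\<^sup>2"
    using gap_nonneg by (intro power_mono)
  also have "\<dots> = (real t * E)\<^sup>2 + 2 * (real t * E) * s + s\<^sup>2" by (simp add: power2_eq_square algebra_simps)
  also have "\<dots> \<le> (real t * E)\<^sup>2 + 2 * gap t * s + s\<^sup>2"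
    using norm_y_diff_le_gap[of t] s0 by (simp add: E_def mult_right_mono)
  finally have 1: "(gap (Suc t))\<^sup>2 \<le> (real t * E)\<^sup>2 + 2 * gap t * s + s\<^sup>2" .
  \<comment> \<open>Firmness scaled by t^2: V is exactly what separates t E from
    \<open>gap t\<close>.\<close>
  have "(real t)\<^sup>2 * (E\<^sup>2 + V\<^sup>2) \<le> (gap t)\<^sup>2"
    using firm[of t "t - 1"] unfolding E_def V_def gap_def power_mult_distrib
    by (intro mult_left_mono) auto
  then have 2: "(real t * E)\<^sup>2 + (real t)\<^sup>2 * V\<^sup>2 \<le> (gap t)\<^sup>2"
    by (simp add: power_mult_distrib algebra_simps)
  have 3: "2 * gap t * s \<le> 45 / 4 * R\<^sup>2 * h / real T"
  proof -
    have "2 * gap t * s \<le> 2 * (9 / 4 * R * h) * (5 / 2 * R / real T)"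
      using g s s0 gap_nonneg[of t] R_pos h by (intro mult_mono) auto
    then show ?thesis by (simp add: power2_eq_square field_simps)
  qed
  have 4: "s\<^sup>2 \<le> 25 / 8 * R\<^sup>2 / real T"
  proof -
    have "s\<^sup>2 \<le> (5 / 2 * R / real T)\<^sup>2" using s s0 by (intro power_mono)
    also have "\<dots> = 25 / 4 * R\<^sup>2 / real T * (1 / real T)" by (simp add: power2_eq_square)
    also have "\<dots> \<le> 25 / 4 * R\<^sup>2 / real T * (1 / 2)"
      using T R_pos by (intro mult_left_mono) (auto simp: field_simps)
    finally show ?thesis by simp
  qed
  have "2 * h \<le> h\<^sup>2" "4 \<le> h\<^sup>2"
    using h power_mono[of 2 h 2] by (auto simp: power2_eq_square)
  then have "45 / 4 * h + 25 / 8 \<le> 7 * h\<^sup>2" by linarith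
  then have "(45 / 4 * h + 25 / 8) * (R\<^sup>2 / real T) \<le> 7 * h\<^sup>2 * (R\<^sup>2 / real T)"
    by (intro mult_right_mono) auto
  then have 5: "45 / 4 * R\<^sup>2 * h / real T + 25 / 8 * R\<^sup>2 / real T \<le> 7 * R\<^sup>2 * h\<^sup>2 / real T"
    by (simp add: algebra_simps)
  have "(real T)\<^sup>2 * V\<^sup>2 \<le> (real t)\<^sup>2 * V\<^sup>2" using T by (intro mult_right_mono power_mono) auto
  then show ?thesis using 1 2 3 4 5 unfolding V_def h_def by linarith
qed

text \<open>Write the increment of y as that of x minus that of x - y and expand the former by
  \<open>x_diff_eq\<close> one index earlier. The extrapolation already predicts its main part; what
  remains is the defect, plus terms of size R h/T^2.\<close>

lemma second_difference:
  assumes T: "T \<ge> 2" "T \<le> t" "t < 2 * T" "t \<le> K"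
  shows "norm (2 *\<^sub>R yh (t - 1) - yh (t - 2) - y t)
     \<le> norm ((x t - y t) - (x (t - 1) - y (t - 1))) + 6 * R * harm (2 * T) / (real T)\<^sup>2"
proof -
  define h :: real where "h = harm (2 * T)"
  define dv where "dv = (x t - y t) - (x (t - 1) - y (t - 1))"
  define s where "s = t - 1"
  have s: "t = Suc s" "s \<ge> 1" "t - 1 = s" "t - 2 = s - 1" using T by (auto simp: s_def)
  have "(2::real) \<le> harm 4" by (simp add: harm_expand)
  also have "harm 4 \<le> h" unfolding h_def using T by (intro harm_mono) auto
  finally have h: "h \<ge> 2" .
  define l where "l = real s / (real s + 1)"
  have l: "0 \<le> l" "l \<le> 1" by (auto simp: l_def)
  have l1: "1 - l = 1 / (real s + 1)" by (simp add: l_def field_simps)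
  define \<kappa> where "\<kappa> = 1 / ((real s + 1) * (real s + 2))"
  have \<kappa>: "\<kappa> \<ge> 0" by (simp add: \<kappa>_def)
  have dx: "x t - x s = l *\<^sub>R (yh s - yh (s - 1)) + \<kappa> *\<^sub>R (yh s - x 0)"
    using x_diff_eq[OF s(2)] s(1) by (simp add: l_def \<kappa>_def)
  let ?r = "2 *\<^sub>R yh s - yh (s - 1) - y t"
  \<comment> \<open>Besides the defect \<open>dv\<close>: an increment of y weighted by 1/(s + 1),
    the anchor term, and inner errors counted at most 2 + 3 times.\<close>
  have split: "?r = dv - l *\<^sub>R ((yh s - y s) - (yh (s - 1) - y (s - 1)))
      + (1 - l) *\<^sub>R (y s - y (s - 1)) - \<kappa> *\<^sub>R (yh s - x 0)
      + (2 *\<^sub>R (yh s - y s) - (yh (s - 1) - y (s - 1)))"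
  proof -
    have "dv = (l *\<^sub>R (yh s - yh (s - 1)) + \<kappa> *\<^sub>R (yh s - x 0)) - (y t - y s)"
      unfolding dv_def s(3) using dx by (simp add: algebra_simps)
    moreover have "(1 - l) *\<^sub>R (y s - y (s - 1)) = (y s - y (s - 1)) - l *\<^sub>R (y s - y (s - 1))"
      by (simp only: scaleR_left_diff_distrib scaleR_one)
    ultimately show ?thesis by (simp add: scaleR_right_diff_distrib scaleR_2)
  qed
  have tri: "norm ?r \<le> norm dv + norm (l *\<^sub>R ((yh s - y s) - (yh (s - 1) - y (s - 1))))
      + norm ((1 - l) *\<^sub>R (y s - y (s - 1))) + norm (\<kappa> *\<^sub>R (yh s - x 0))
      + norm (2 *\<^sub>R (yh s - y s) - (yh (s - 1) - y (s - 1)))"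
  proof -
    have "norm (a - b + c - d + f) \<le> norm a + norm b + norm c + norm d + norm f"
      for a b c d f :: 'a
      using norm_triangle_ineq[of "a - b + c - d" f] norm_triangle_ineq4[of "a - b + c" d]
        norm_triangle_ineq[of "a - b" c] norm_triangle_ineq4[of a b] by linarith
    then show ?thesis unfolding split .
  qed
  have l_term: "norm (l *\<^sub>R ((yh s - y s) - (yh (s - 1) - y (s - 1)))) \<le> 2 * e"
  proof -
    have "norm (l *\<^sub>R ((yh s - y s) - (yh (s - 1) - y (s - 1))))
        \<le> 1 * norm ((yh s - y s) - (yh (s - 1) - y (s - 1)))"
      unfolding norm_scaleR using l by (intro mult_right_mono) auto
    also have "\<dots> \<le> norm (yh s - y s) + norm (yh (s - 1) - y (s - 1))"
      using norm_triangle_ineq4[of "yh s - y s" "yh (s - 1) - y (s - 1)"] by simp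
    finally show ?thesis using err[of s] err[of "s - 1"] by linarith
  qed
  have two_term: "norm (2 *\<^sub>R (yh s - y s) - (yh (s - 1) - y (s - 1))) \<le> 3 * e"
  proof -
    have "norm (2 *\<^sub>R (yh s - y s) - (yh (s - 1) - y (s - 1)))
       \<le> 2 * norm (yh s - y s) + norm (yh (s - 1) - y (s - 1))"
      using norm_triangle_ineq4[of "2 *\<^sub>R (yh s - y s)" "yh (s - 1) - y (s - 1)"] by simp
    then show ?thesis using err[of s] err[of "s - 1"] by linarith
  qed
  have 0: "norm ?r \<le> norm dv + 5 * e + norm ((1 - l) *\<^sub>R (y s - y (s - 1)))
       + norm (\<kappa> *\<^sub>R (yh s - x 0))" using tri l_term two_term by linarith
  have T2: "(real T)\<^sup>2 > 0" using T by simp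
  have et: "e * (real T)\<^sup>2 \<le> R / 64" using e_sq[of T] T by auto
  have rT: "real T \<le> real s + 1" "2 \<le> real T" using T s by auto
  have 1: "(real T)\<^sup>2 * norm ((1 - l) *\<^sub>R (y s - y (s - 1))) \<le> 9 / 2 * R * h"
  proof -
    have "gap s \<le> 9 / 4 * R * h" unfolding h_def using T s by (intro gap_le_harm) auto
    then have g: "real s * norm (y s - y (s - 1)) \<le> 9 / 4 * R * h"
      using norm_y_diff_le_gap[of s] by linarith
    have "(real T)\<^sup>2 \<le> (real s + 1)\<^sup>2" using rT by (intro power_mono) auto
    also have "\<dots> = (real s + 1) * (real s + 1)" by (simp add: power2_eq_square)
    also have "\<dots> \<le> 2 * real s * (real s + 1)" using s by (intro mult_right_mono) auto
    finally have "(real T)\<^sup>2 / (real s + 1) \<le> 2 * real s" by (simp add: field_simps)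
    then have "(real T)\<^sup>2 / (real s + 1) * norm (y s - y (s - 1)) \<le> 2 * real s * norm (y s - y (s - 1))"
      by (intro mult_right_mono) auto
    also have "\<dots> \<le> 9 / 2 * R * h" using g by linarith
    finally show ?thesis by (simp add: l1)
  qed
  have 2: "(real T)\<^sup>2 * norm (\<kappa> *\<^sub>R (yh s - x 0)) \<le> 9 / 4 * R"
  proof -
    have "(real T)\<^sup>2 \<le> (real s + 1) * (real s + 2)"
      using rT unfolding power2_eq_square by (intro mult_mono) auto
    then have "(real T)\<^sup>2 * \<kappa> \<le> 1" by (simp add: \<kappa>_def)
    then have "(real T)\<^sup>2 * \<kappa> * norm (yh s - x 0) \<le> 1 * norm (yh s - x 0)"
      by (intro mult_right_mono) auto
    then show ?thesis using norm_yh_diff_start[of s] \<kappa> s T by (simp add: mult_ac)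
  qed
  have "5 * (e * (real T)\<^sup>2) + 9 / 2 * R * h + 9 / 4 * R \<le> 6 * R * h"
  proof -
    have "R * 2 \<le> R * h" using h R_pos by (intro mult_left_mono) auto
    then show ?thesis using et R_pos by linarith
  qed
  then have "(real T)\<^sup>2 * (5 * e + norm ((1 - l) *\<^sub>R (y s - y (s - 1)))
       + norm (\<kappa> *\<^sub>R (yh s - x 0))) \<le> 6 * R * h"
    using 1 2 by (simp add: algebra_simps)
  then have "5 * e + norm ((1 - l) *\<^sub>R (y s - y (s - 1))) + norm (\<kappa> *\<^sub>R (yh s - x 0))
      \<le> 6 * R * h / (real T)\<^sup>2"
    using T2 by (simp add: field_simps)
  then have "norm ?r \<le> norm dv + 6 * R * h / (real T)\<^sup>2" using 0 by linarith
  then show ?thesis unfolding dv_def h_def s(3,4) .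
qed

text \<open>The squared gaps telescope, leaving at most the initial one, worth 81/8 c; at most T
  forcing terms of 50 c/T add 50 c, and 64 rounds up the total. The end n is free because the last
  block is cut off at K.\<close>

lemma second_difference_block:
  assumes T: "T \<ge> 2" "T \<le> n" "n < 2 * T" "n \<le> K"
  shows "(\<Sum>t=T..n. (norm (2 *\<^sub>R yh (t - 1) - yh (t - 2) - y t))\<^sup>2)
     \<le> 64 * R\<^sup>2 * (harm (2 * T))\<^sup>2 / (real T)\<^sup>2"
proof -
  define h :: real where "h = harm (2 * T)"
  define c where "c = R\<^sup>2 * h\<^sup>2 / (real T)\<^sup>2"
  have c: "c \<ge> 0" by (simp add: c_def)
  have T0: "real T > 0" "2 \<le> real T" using T by auto
  have "(2::real) \<le> harm 4" by (simp add: harm_expand)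
  also have "harm 4 \<le> h" unfolding h_def using T by (intro harm_mono) auto
  finally have h: "h \<ge> 2" .
  define r where "r t = norm (2 *\<^sub>R yh (t - 1) - yh (t - 2) - y t)" for t
  have step: "(r t)\<^sup>2 \<le> 2 / (real T)\<^sup>2 * ((gap t)\<^sup>2 - (gap (Suc t))\<^sup>2) + 50 * c / real T"
    if t: "t \<in> {T..n}" for t
  proof -
    define V where "V = norm ((x t - y t) - (x (t - 1) - y (t - 1)))"
    have "r t \<le> V + 6 * R * h / (real T)\<^sup>2"
      using second_difference[of T t] t T by (simp add: r_def V_def h_def)
    then have "(r t)\<^sup>2 \<le> (V + 6 * R * h / (real T)\<^sup>2)\<^sup>2"
      by (intro power_mono) (auto simp: r_def)
    also have "\<dots> \<le> 2 * V\<^sup>2 + 2 * (6 * R * h / (real T)\<^sup>2)\<^sup>2"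
      using sum_squares_bound[of V "6 * R * h / (real T)\<^sup>2"] unfolding power2_sum by linarith
    also have "2 * (6 * R * h / (real T)\<^sup>2)\<^sup>2 = 72 * c / real T * (1 / real T)"
      by (simp add: c_def power2_eq_square mult_ac)
    also have "\<dots> \<le> 72 * c / real T * (1 / 2)"
      using T0 c by (intro mult_left_mono) (auto simp: field_simps)
    finally have 1: "(r t)\<^sup>2 \<le> 2 * V\<^sup>2 + 36 * c / real T" by simp
    have "(real T)\<^sup>2 * V\<^sup>2 \<le> (gap t)\<^sup>2 - (gap (Suc t))\<^sup>2 + 7 * R\<^sup>2 * h\<^sup>2 / real T"
      using gap_decrease[of T t] t T by (simp add: V_def h_def)
    then have "2 / (real T)\<^sup>2 * ((real T)\<^sup>2 * V\<^sup>2)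
        \<le> 2 / (real T)\<^sup>2 * ((gap t)\<^sup>2 - (gap (Suc t))\<^sup>2 + 7 * R\<^sup>2 * h\<^sup>2 / real T)"
      by (intro mult_left_mono) auto
    also have "\<dots> = 2 / (real T)\<^sup>2 * ((gap t)\<^sup>2 - (gap (Suc t))\<^sup>2) + 14 * c / real T"
      using T0 by (simp add: c_def field_simps)
    finally show ?thesis using 1 T0 by simp
  qed
  have "(\<Sum>t=T..n. (r t)\<^sup>2)
      \<le> (\<Sum>t=T..n. 2 / (real T)\<^sup>2 * ((gap t)\<^sup>2 - (gap (Suc t))\<^sup>2) + 50 * c / real T)"
    by (intro sum_mono step)
  also have "\<dots> = 2 / (real T)\<^sup>2 * (\<Sum>t=T..n. (gap t)\<^sup>2 - (gap (Suc t))\<^sup>2)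
      + real (Suc n - T) * (50 * c / real T)"
    by (simp add: sum.distrib sum_distrib_left)
  also have "(\<Sum>t=T..n. (gap t)\<^sup>2 - (gap (Suc t))\<^sup>2) = (gap T)\<^sup>2 - (gap (Suc n))\<^sup>2"
    using sum_Suc_diff[of T n "\<lambda>t. - (gap t)\<^sup>2"] T by simp
  finally have 1: "(\<Sum>t=T..n. (r t)\<^sup>2) \<le> 2 / (real T)\<^sup>2 * ((gap T)\<^sup>2 - (gap (Suc n))\<^sup>2)
      + real (Suc n - T) * (50 * c / real T)" .
  have "(gap T)\<^sup>2 - (gap (Suc n))\<^sup>2 \<le> (9 / 4 * R * h)\<^sup>2"
  proof -
    have "gap T \<le> 9 / 4 * R * h" unfolding h_def using T by (intro gap_le_harm) auto
    then have "(gap T)\<^sup>2 \<le> (9 / 4 * R * h)\<^sup>2" using gap_nonneg by (intro power_mono) auto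
    then show ?thesis by (smt (verit) zero_le_power2)
  qed
  then have "2 / (real T)\<^sup>2 * ((gap T)\<^sup>2 - (gap (Suc n))\<^sup>2) \<le> 2 / (real T)\<^sup>2 * (9 / 4 * R * h)\<^sup>2"
    by (intro mult_left_mono) auto
  also have "\<dots> = 81 / 8 * c" by (simp add: c_def power2_eq_square)
  finally have 2: "2 / (real T)\<^sup>2 * ((gap T)\<^sup>2 - (gap (Suc n))\<^sup>2) \<le> 81 / 8 * c" .
  have "real (Suc n - T) * (50 * c / real T) \<le> real T * (50 * c / real T)"
    using T c by (intro mult_right_mono) auto
  also have "\<dots> = 50 * c" using T0 by simp
  finally have "(\<Sum>t=T..n. (r t)\<^sup>2) \<le> 64 * c" using 1 2 c by linarith
  then show ?thesis by (simp add: r_def c_def h_def mult.assoc)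
qed

text \<open>At t = 0 and t = 1 there is nothing to extrapolate from; these two calls give the term 2
  * 3^a of \<open>U_sum\<close>.\<close>

lemma first_steps:
  "norm (x 0 - y 0) \<le> 3 * R" "norm (yh 0 - y 1) \<le> 3 * R"
proof -
  have "norm (x 0 - y 0) \<le> norm (x 0 - zs) + norm (y 0 - zs)"
    by (metis dist_norm dist_triangle2)
  then show "norm (x 0 - y 0) \<le> 3 * R" using start fejer[of 0] R_pos by linarith
  have "e * 1 \<le> e * (real K + 2)\<^sup>2"
    using e_pos by (intro mult_left_mono) (auto intro: one_le_power)
  then have e: "e \<le> R / 16" using e_K_plus_2 by simp
  have "norm (yh 0 - y 1) \<le> norm (yh 0 - y 0) + norm (y 1 - y 0)"
    by (metis dist_norm dist_triangle2)
  moreover have "norm (y 1 - y 0) \<le> gap 1" using norm_y_diff_le_gap[of 1] by simp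
  moreover have "gap 1 \<le> 9 / 8 * R + e"
    using gap_le[of 1] by (simp add: harm_expand numeral_2_eq_2 harm_Suc)
  ultimately show "norm (yh 0 - y 1) \<le> 3 * R" using err[of 0] e R_pos by linarith
qed

end

section \<open>Power sums over dyadic blocks\<close>

text \<open>Jensen's inequality for power means. N may exceed the number of terms because N^(1 -
  a/2) V^(a/2) does not decrease in N when a \<le> 2.\<close>

lemma sum_powr_le:
  fixes f :: "'i \<Rightarrow> real"
  assumes "finite I" "real (card I) \<le> N" "N > 0" "\<And>i. i \<in> I \<Longrightarrow> f i \<ge> 0"
    and "(\<Sum>i\<in>I. (f i)\<^sup>2) \<le> V" "V > 0" "0 < a" "a \<le> 2"
  shows "(\<Sum>i\<in>I. f i powr a) \<le> N * (V / N) powr (a / 2)"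
proof -
  define c where "c = V / N"
  define \<theta> where "\<theta> = a / 2"
  have \<theta>: "0 < \<theta>" "\<theta> \<le> 1" using assms by (auto simp: \<theta>_def)
  have c: "c > 0" using assms by (simp add: c_def)
  \<comment> \<open>concavity of \<open>u \<mapsto> u powr \<theta>\<close>, in the form of its tangent at the mean value \<open>c\<close>\<close>
  have young: "f i powr a \<le> c powr \<theta> * (\<theta> * ((f i)\<^sup>2 / c) + (1 - \<theta>))" if "i \<in> I" for i
  proof (cases "f i = 0")
    case True
    then show ?thesis using \<theta> c by simp
  next
    case False
    then have f: "f i > 0" using assms(4)[OF that] by simp
    have "((f i)\<^sup>2 / c) powr \<theta> * 1 powr (1 - \<theta>) \<le> \<theta> * ((f i)\<^sup>2 / c) + (1 - \<theta>) * 1"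
      using \<theta> f c by (intro Youngs_inequality_0) auto
    moreover have "((f i)\<^sup>2 / c) powr \<theta> = f i powr a / c powr \<theta>"
    proof -
      have "(f i)\<^sup>2 = f i powr 2" using f by simp
      then have "((f i)\<^sup>2) powr \<theta> = f i powr a" using f by (simp add: powr_powr \<theta>_def del: powr_numeral)
      then show ?thesis using f c by (simp add: powr_divide)
    qed
    ultimately show ?thesis using c by (simp add: field_simps)
  qed
  have "(\<Sum>i\<in>I. f i powr a) \<le> (\<Sum>i\<in>I. c powr \<theta> * (\<theta> * ((f i)\<^sup>2 / c) + (1 - \<theta>)))"
    by (intro sum_mono young)
  also have "\<dots> = c powr \<theta> * (\<theta> * ((\<Sum>i\<in>I. (f i)\<^sup>2) / c) + real (card I) * (1 - \<theta>))"
    unfolding sum_distrib_left[symmetric] sum.distrib sum_divide_distrib by simp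
  also have "\<dots> \<le> c powr \<theta> * (\<theta> * (V / c) + N * (1 - \<theta>))"
    using assms(2,5) \<theta> c
    by (intro mult_left_mono add_mono mult_right_mono divide_right_mono) auto
  also have "V / c = N" using assms(3,6) by (simp add: c_def)
  finally show ?thesis by (simp add: c_def \<theta>_def algebra_simps)
qed

lemma sum_dyadic_blocks:
  fixes f :: "nat \<Rightarrow> 'a::comm_monoid_add"
  shows "(\<Sum>t=2..<2 ^ (J + 1). f t) = (\<Sum>j=1..J. \<Sum>t=2 ^ j..<2 ^ (j + 1). f t)"
proof (induction J)
  case (Suc J)
  have "(\<Sum>t=2..<2 ^ (Suc J + 1). f t)
      = (\<Sum>t=2..<2 ^ (J + 1). f t) + (\<Sum>t=2 ^ (J + 1)..<2 ^ (Suc J + 1). f t)"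
    using power_increasing[of 1 "J + 1" "2::nat"]
    by (intro sum.atLeastLessThan_concat[symmetric]) auto
  then show ?case using Suc by simp
qed simp

lemma less_two_power_floor_log:
  assumes "K \<ge> 1"
  shows "K < 2 ^ (nat \<lfloor>log 2 (real K)\<rfloor> + 1)"
proof -
  define J where "J = nat \<lfloor>log 2 (real K)\<rfloor>"
  have "log 2 (real K) \<ge> 0" using assms by simp
  then have "log 2 (real K) < real J + 1" unfolding J_def by linarith
  then have "real K < 2 powr (real J + 1)" using assms by (simp add: log_less_iff)
  also have "\<dots> = 2 ^ (J + 1)" by (simp add: powr_add powr_realpow)
  finally show ?thesis unfolding J_def[symmetric] by (metis of_nat_less_iff of_nat_numeral of_nat_power)
qed

lemma two_power_floor_log_le:
  assumes "K \<ge> 1" "j \<le> nat \<lfloor>log 2 (real K)\<rfloor>"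
  shows "2 ^ j \<le> K"
proof -
  have "log 2 (real K) \<ge> 0" using assms by simp
  then have "real j \<le> log 2 (real K)" using assms(2) by linarith
  then have "2 powr real j \<le> real K" using assms(1) by (simp add: le_log_iff)
  then have "real (2 ^ j) \<le> real K" by (simp add: powr_realpow)
  then show ?thesis by (simp only: of_nat_le_iff)
qed

text \<open>A block starting at T = 2^j has at most T terms and quadratic mean squared of order (8 R
  h)^2/T^3, so its a-th powers sum to order (R h)^a T^(1 - 3a/2). The factors 16 and 1 + h of
  \<open>U_sum\<close> only round up.\<close>

lemma sum_powr_le_U_sum:
  fixes r :: "nat \<Rightarrow> real"
  assumes nonneg: "\<And>t. r t \<ge> 0" and r0: "r 0 \<le> 3 * R" and r1: "r 1 \<le> 3 * R"
    and "R > 0" "K \<ge> 2" "0 < a" "a \<le> 2"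
    and block: "\<And>T n. \<lbrakk>2 \<le> T; T \<le> n; n < 2 * T; n \<le> K\<rbrakk> \<Longrightarrow>
      (\<Sum>t=T..n. (r t)\<^sup>2) \<le> 64 * R\<^sup>2 * (harm (2 * T))\<^sup>2 / (real T)\<^sup>2"
  shows "(\<Sum>t=0..K. r t powr a) \<le> R powr a * U_sum a K"
proof -
  define J where "J = nat \<lfloor>log 2 (real K)\<rfloor>"
  \<comment> \<open>Extension by 0 beyond K lets the incomplete last block be summed like a full
    one.\<close>
  define f where "f t = (if t \<le> K then r t powr a else 0)" for t
  define B where "B j = (16 * R * (1 + harm (2 ^ (j + 1)))) powr a * 2 powr (real j * (1 - 3 * a / 2))" for j
  have KJ: "K < 2 ^ (J + 1)" using less_two_power_floor_log[of K] \<open>K \<ge> 2\<close> by (simp add: J_def)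
  have blk: "(\<Sum>t=2 ^ j..<2 ^ (j + 1). f t) \<le> B j" if j: "j \<in> {1..J}" for j
  proof -
    define T :: nat where "T = 2 ^ j"
    define n where "n = min K (2 * T - 1)"
    define h :: real where "h = harm (2 * T)"
    have T2: "T \<ge> 2" using j power_increasing[of 1 j "2::nat"] by (auto simp: T_def)
    have TK: "T \<le> K" using two_power_floor_log_le[of K j] j \<open>K \<ge> 2\<close> by (simp add: T_def J_def)
    have n: "T \<le> n" "n < 2 * T" "n \<le> K" using T2 TK by (auto simp: n_def)
    have h: "h > 0" using T2 by (simp add: h_def)
    define V where "V = 64 * R\<^sup>2 * h\<^sup>2 / (real T)\<^sup>2"
    have V: "V > 0" using h T2 \<open>R > 0\<close> by (simp add: V_def)
    have "(\<Sum>t=2 ^ j..<2 ^ (j + 1). f t) = (\<Sum>t=T..n. r t powr a)"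
      unfolding f_def T_def[symmetric] using T2
      by (intro sum.mono_neutral_cong_right) (auto simp: n_def T_def)
    also have "\<dots> \<le> real T * (V / real T) powr (a / 2)"
      using block[OF T2 n] nonneg V n T2 \<open>0 < a\<close> \<open>a \<le> 2\<close>
      by (intro sum_powr_le) (auto simp: V_def h_def)
    also have "\<dots> \<le> real T * ((16 * R * (1 + h))\<^sup>2 * 2 powr (- 3 * real j)) powr (a / 2)"
    proof (intro mult_left_mono powr_mono2)
      have "2 powr (- 3 * real j) = 1 / real T ^ 3"
        by (simp add: T_def powr_minus powr_realpow[symmetric] powr_powr divide_inverse mult.commute)
      moreover have "64 * R\<^sup>2 * h\<^sup>2 \<le> (16 * R * (1 + h))\<^sup>2"
        using h \<open>R > 0\<close> by (simp add: power2_eq_square algebra_simps add_nonneg_nonneg)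
      ultimately show "V / real T \<le> (16 * R * (1 + h))\<^sup>2 * 2 powr (- 3 * real j)"
        by (simp add: V_def power2_eq_square power3_eq_cube divide_right_mono)
    qed (use V \<open>0 < a\<close> in auto)
    also have "\<dots> = real T * ((16 * R * (1 + h)) powr a * 2 powr (- 3 * real j * (a / 2)))"
    proof -
      have pos: "16 * R * (1 + h) > 0" using h \<open>R > 0\<close> by simp
      have "(16 * R * (1 + h))\<^sup>2 = (16 * R * (1 + h)) powr 2" using pos by simp
      then have "((16 * R * (1 + h))\<^sup>2) powr (a / 2) = (16 * R * (1 + h)) powr a"
        using pos by (simp add: powr_powr del: powr_numeral)
      then show ?thesis by (simp add: powr_mult powr_powr)
    qed
    also have "real T = 2 powr real j" by (simp add: T_def powr_realpow)
    also have "2 powr real j * ((16 * R * (1 + h)) powr a * 2 powr (- 3 * real j * (a / 2)))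
        = (16 * R * (1 + h)) powr a * 2 powr (real j * (1 - 3 * a / 2))"
      by (simp add: powr_add[symmetric] algebra_simps)
    finally show ?thesis by (simp add: B_def h_def T_def)
  qed
  have "(\<Sum>t=0..K. r t powr a) = (\<Sum>t\<in>{0, 1} \<union> {2..<2 ^ (J + 1)}. f t)"
    using \<open>K \<ge> 2\<close> KJ by (intro sum.mono_neutral_cong_left) (auto simp: f_def)
  also have "\<dots> = (\<Sum>t\<in>{0, 1}. f t) + (\<Sum>t=2..<2 ^ (J + 1). f t)"
    by (intro sum.union_disjoint) auto
  also have "\<dots> \<le> 2 * (3 * R) powr a + (\<Sum>j=1..J. B j)"
  proof (rule add_mono)
    have "r 0 powr a \<le> (3 * R) powr a" "r 1 powr a \<le> (3 * R) powr a"
      using nonneg r0 r1 \<open>0 < a\<close> by (auto intro!: powr_mono2)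
    then show "(\<Sum>t\<in>{0, 1}. f t) \<le> 2 * (3 * R) powr a" using \<open>K \<ge> 2\<close> by (simp add: f_def)
    show "(\<Sum>t=2..<2 ^ (J + 1). f t) \<le> (\<Sum>j=1..J. B j)"
      unfolding sum_dyadic_blocks by (intro sum_mono blk)
  qed
  also have "\<dots> = R powr a * U_sum a K"
  proof -
    have "B j = R powr a * (16 powr a *
        ((1 + harm (2 ^ (j + 1))) powr a * 2 powr (real j * (1 - 3 * a / 2))))" for j
      using \<open>R > 0\<close> harm_nonneg[of "2 ^ (j + 1)", where ?'a = real]
      unfolding B_def by (simp add: powr_mult)
    then have "(\<Sum>j=1..J. B j) = R powr a * (16 powr a *
        (\<Sum>j=1..J. (1 + harm (2 ^ (j + 1))) powr a * 2 powr (real j * (1 - 3 * a / 2))))"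
      by (simp only: sum_distrib_left)
    moreover have "2 * (3 * R) powr a = R powr a * (2 * 3 powr a)"
      using \<open>R > 0\<close> by (simp add: powr_mult)
    ultimately show ?thesis unfolding U_sum_def J_def[symmetric] by (simp only: distrib_left)
  qed
  finally show ?thesis .
qed

section \<open>Logarithmic factors and the query cap\<close>

lemma harm_le_one_plus_ln:
  assumes "n \<ge> 1"
  shows "harm n \<le> 1 + ln (real n)"
  using euler_mascheroni_sequence_decreasing[of 1 n] assms by (simp add: harm_expand)

lemma L_A_ge_2:
  assumes "L > 0" "0 < R" "R \<le> D" "\<epsilon> > 0"
  shows "L_A p L D R \<epsilon> \<ge> 2"
proof -
  have "D / R \<ge> 1" using assms by simp
  moreover have "L * R ^ p / \<epsilon> > 0" using assms by simp
  ultimately have "exp 1 \<le> 2 + D / R + L * R ^ p / \<epsilon>" using exp_le by linarith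
  then have "1 \<le> ln (2 + D / R + L * R ^ p / \<epsilon>)"
    by (metis exp_gt_zero ln_exp ln_mono order_less_le_trans)
  then show ?thesis by (simp add: L_A_def)
qed

text \<open>In the scale-free quantities D/R and Q, the argument of the logarithm in
  \<open>L_S\<close> is at most 290 Y^(p + 5), where ln Y is the logarithm in \<open>L_A\<close>.
  Since Y \<ge> 3, the constant is below Y^6; this is the origin of p + 11 in
  \<open>residual_const\<close>.\<close>

lemma L_S_le_L_A:
  fixes K :: nat
  assumes "p \<ge> 2" "L > 0" "0 < R" "R \<le> D" "\<epsilon> > 0"
    and K_le: "real K + 2 \<le> 2 * (2 + D / R + Q_R p L R \<epsilon>)"
  shows "L_S p L D (1 / prox_step R \<epsilon> K) (inner_error R K / prox_step R \<epsilon> K)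
    \<le> (real p + 11) * L_A p L D R \<epsilon>"
proof -
  define \<rho> where "\<rho> = D / R"
  define Q where "Q = L * R ^ p / \<epsilon>"
  define Y where "Y = 2 + \<rho> + Q"
  define c where "c = (1 + harm (K + 1)) / (real K + 1)"
  define k where "k = real K + 2"
  define \<eta> where "\<eta> = prox_step R \<epsilon> K"
  have \<rho>: "\<rho> \<ge> 1" "D = \<rho> * R" using assms by (auto simp: \<rho>_def)
  have Q: "Q > 0" using assms by (simp add: Q_def)
  have Y: "Y \<ge> 3" "\<rho> \<le> Y" "Q \<le> Y" using \<rho> Q by (auto simp: Y_def)
  have k: "k > 0" "k \<le> 2 * Y" using K_le by (auto simp: k_def Y_def \<rho>_def Q_def Q_R_def)
  have c: "0 < c" "c \<le> 2"
  proof -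
    have "harm (K + 1) \<le> 1 + ln (real (K + 1))" by (rule harm_le_one_plus_ln) simp
    also have "\<dots> \<le> real K + 1" using ln_le_minus_one[of "real (K + 1)"] by simp
    finally show "c \<le> 2" by (simp add: c_def field_simps)
    show "0 < c" using harm_nonneg[of "K + 1", where ?'a = real] by (simp add: c_def add_pos_nonneg)
  qed
  have \<eta>: "\<eta> = 8 * R * c / \<epsilon>" by (simp add: \<eta>_def prox_step_def c_def)
  have \<eta>_pos: "\<eta> > 0" using \<eta> c assms by simp
  have e: "inner_error R K = R / k ^ 4" by (simp add: inner_error_def k_def)
  have Rp: "R ^ p = R * R ^ (p - 1)" using assms(1) by (cases p) auto
  have t1: "L * D ^ (p - 1) / (1 / \<eta>) = 8 * c * (\<rho> ^ (p - 1) * Q)"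
    by (simp add: \<eta> \<rho>(2) Q_def Rp power_mult_distrib)
  have t2: "L * D ^ p / (inner_error R K / \<eta>) = 8 * c * (\<rho> ^ p * Q) * k ^ 4"
    using assms(3) by (simp add: e \<eta> \<rho>(2) Q_def power_mult_distrib)
  have t3: "1 / \<eta> * D / (inner_error R K / \<eta>) = \<rho> * k ^ 4"
    using assms(3) \<eta>_pos by (simp add: e \<rho>(2))
  have k4: "k ^ 4 \<le> 16 * Y ^ 4"
    using power_mono[of k "2 * Y" 4] k by (simp add: power_mult_distrib)
  have pw: "Y ^ m \<le> Y ^ (p + 5)" if "m \<le> p + 5" for m
    using that Y by (intro power_increasing) auto
  have b1: "8 * c * (\<rho> ^ (p - 1) * Q) \<le> 16 * Y ^ (p + 5)"
  proof -
    have "8 * c * (\<rho> ^ (p - 1) * Q) \<le> 8 * 2 * (Y ^ (p - 1) * Y)"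
      using c \<rho> Q Y by (intro mult_mono power_mono) auto
    also have "Y ^ (p - 1) * Y = Y ^ p" using assms(1) by (cases p) auto
    finally show ?thesis using pw[of p] by simp
  qed
  have b2: "8 * c * (\<rho> ^ p * Q) * k ^ 4 \<le> 256 * Y ^ (p + 5)"
  proof -
    have "8 * c * (\<rho> ^ p * Q) * k ^ 4 \<le> 8 * 2 * (Y ^ p * Y) * (16 * Y ^ 4)"
      using c \<rho> Q Y k k4 by (intro mult_mono power_mono) auto
    also have "\<dots> = 256 * Y ^ (p + 5)" by (simp add: power_add power4_eq_xxxx eval_nat_numeral)
    finally show ?thesis .
  qed
  have b3: "\<rho> * k ^ 4 \<le> 16 * Y ^ (p + 5)"
  proof -
    have "\<rho> * k ^ 4 \<le> Y * (16 * Y ^ 4)"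
      using \<rho> Y k k4 by (intro mult_mono) auto
    also have "\<dots> = 16 * Y ^ 5" by (simp add: eval_nat_numeral)
    finally show ?thesis using pw[of 5] by simp
  qed
  have b0: "1 \<le> Y ^ (p + 5)" using Y by (intro one_le_power) auto
  let ?s = "2 + 8 * c * (\<rho> ^ (p - 1) * Q) + 8 * c * (\<rho> ^ p * Q) * k ^ 4 + \<rho> * k ^ 4"
  have "?s \<le> 290 * Y ^ (p + 5)" using b0 b1 b2 b3 by linarith
  also have "\<dots> \<le> Y ^ 6 * Y ^ (p + 5)"
    using power_mono[of 3 Y 6] Y by (intro mult_right_mono) auto
  also have "\<dots> = Y ^ (p + 11)" by (simp add: add.commute flip: power_add)
  finally have le: "?s \<le> Y ^ (p + 11)" .
  have pos: "?s > 0" using c \<rho> Q k by (intro add_pos_nonneg) auto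
  have "L_S p L D (1 / \<eta>) (inner_error R K / \<eta>) = 1 + ln ?s"
    unfolding L_S_def t1 t2 t3 ..
  also have "\<dots> \<le> 1 + ln (Y ^ (p + 11))" using le pos by (simp add: ln_mono)
  also have "\<dots> = 1 + (real p + 11) * ln Y" using Y by (simp add: ln_realpow)
  also have "\<dots> \<le> (real p + 11) * (1 + ln Y)" by (simp add: algebra_simps)
  also have "1 + ln Y = L_A p L D R \<epsilon>" by (simp add: L_A_def Y_def \<rho>_def Q_def)
  finally show ?thesis by (simp only: \<eta>_def)
qed

text \<open>\<open>2 / 3 \<le> a\<close> makes the exponent 1 - 3a/2 nonpositive, so each block
  costs at most (2 l)^2, and there are at most 2 l blocks. The constant covers 256 * 8 plus the
  first two steps.\<close>

lemma U_sum_le: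
  assumes "K \<ge> 2" "2 / 3 \<le> a" "a \<le> 2" "l \<ge> 2" "ln (real K) \<le> l - 1"
  shows "U_sum a K \<le> 2100 * l ^ 3"
proof -
  define J where "J = nat \<lfloor>log 2 (real K)\<rfloor>"
  have lnK: "ln (real K) \<ge> 0" using assms by simp
  have l0: "log 2 (real K) \<ge> 0" using assms by simp
  have J: "real J \<le> 2 * l"
  proof -
    have "real J \<le> log 2 (real K)" using l0 unfolding J_def by linarith
    also have "\<dots> = ln (real K) / ln 2" by (simp add: log_def)
    also have "\<dots> \<le> ln (real K) / (2 / 3)"
      using ln2_ge_two_thirds lnK by (intro divide_left_mono) auto
    finally show ?thesis using assms by simp
  qed
  have term_le: "(1 + harm (2 ^ (j + 1))) powr a * 2 powr (real j * (1 - 3 * a / 2)) \<le> (2 * l)\<^sup>2"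
    if "j \<in> {1..J}" for j
  proof -
    have "real j \<le> log 2 (real K)" using that l0 unfolding J_def by simp linarith
    then have "2 powr real j \<le> real K" using assms(1) by (simp add: le_log_iff)
    then have jK: "(2::real) ^ j \<le> real K" by (simp add: powr_realpow)
    have "harm (2 ^ (j + 1)) \<le> 1 + ln (real (2 ^ (j + 1)))" by (rule harm_le_one_plus_ln) simp
    also have "ln (real (2 ^ (j + 1))) \<le> ln (2 * real K)"
      using jK assms(1) by (intro ln_mono) auto
    also have "\<dots> = ln 2 + ln (real K)" using assms(1) by (simp add: ln_mult)
    also have "\<dots> \<le> l" using assms(5) ln_le_minus_one[of "2::real"] by simp
    finally have h: "1 + harm (2 ^ (j + 1)) \<le> 2 * l" using assms(4) by simp
    have h1: "1 \<le> 1 + (harm (2 ^ (j + 1)) :: real)" using harm_nonneg by simp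
    have "(1 + harm (2 ^ (j + 1))) powr a \<le> (1 + harm (2 ^ (j + 1)) :: real) powr 2"
      using h1 assms(3) by (intro powr_mono) auto
    also have "\<dots> \<le> (2 * l) powr 2" using h h1 by (intro powr_mono2) auto
    also have "\<dots> = (2 * l)\<^sup>2" using assms(4) by simp
    finally have 1: "(1 + harm (2 ^ (j + 1))) powr a \<le> (2 * l)\<^sup>2" .
    have "real j * (1 - 3 * a / 2) \<le> 0" using assms(2) by (intro mult_nonneg_nonpos) auto
    then have "2 powr (real j * (1 - 3 * a / 2)) \<le> 2 powr 0" by (intro powr_mono) auto
    then show ?thesis using mult_mono[OF 1, of "2 powr (real j * (1 - 3 * a / 2))" 1] by simp
  qed
  have "(\<Sum>j=1..J. (1 + harm (2 ^ (j + 1))) powr a * 2 powr (real j * (1 - 3 * a / 2)))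
      \<le> (\<Sum>j=1..J. (2 * l)\<^sup>2)"
    by (intro sum_mono term_le)
  also have "\<dots> = real J * (2 * l)\<^sup>2" by simp
  also have "\<dots> \<le> 2 * l * (2 * l)\<^sup>2" using J by (intro mult_right_mono) auto
  also have "\<dots> = 8 * l ^ 3" by (simp add: power2_eq_square power3_eq_cube)
  finally have S: "(\<Sum>j=1..J. (1 + harm (2 ^ (j + 1))) powr a * 2 powr (real j * (1 - 3 * a / 2)))
      \<le> 8 * l ^ 3" .
  have p16: "16 powr a \<le> (256::real)" using powr_mono[of a 2 "16::real"] assms(3) by simp
  have p3: "3 powr a \<le> (9::real)" using powr_mono[of a 2 "3::real"] assms(3) by simp
  have l3: "8 \<le> l ^ 3" using power_mono[of 2 l 3] assms(4) by simp
  have "16 powr a * (\<Sum>j=1..J. (1 + harm (2 ^ (j + 1))) powr a * 2 powr (real j * (1 - 3 * a / 2)))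
      \<le> 256 * (8 * l ^ 3)"
    by (intro mult_mono p16 S sum_nonneg) auto
  then show ?thesis unfolding U_sum_def J_def[symmetric] using p3 l3 by linarith
qed

text \<open>As K is at least Q^\<alpha>, (Q/K)^\<gamma> is at most Q^((1 - \<alpha>) \<gamma>), and
  \<alpha> = \<gamma>/(1 + \<gamma>) solves (1 - \<alpha>) \<gamma> = \<alpha>. So the outer step
  count and the warm start cost are both of order Q^\<alpha>, up to logarithms.\<close>

lemma query_cap_le:
  fixes p :: nat and L D R \<epsilon> \<gamma> b C\<^sub>S :: real
  defines "Q \<equiv> Q_R p L R \<epsilon>" and "\<alpha> \<equiv> \<gamma> / (1 + \<gamma>)"
  defines "K \<equiv> max 2 (nat \<lceil>Q powr \<alpha>\<rceil>)"
  assumes "p \<ge> 2" "L > 0" "0 < R" "R \<le> D" "\<epsilon> > 0" "0 < \<gamma>" "\<gamma> \<le> 1"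
    and a: "(real p - 1) * \<gamma> \<le> 2" "3 / 2 * ((real p - 1) * \<gamma>) \<ge> 1"
    and C: "C\<^sub>S > 0" "b \<ge> 0"
  shows "real (query_cap p L D C\<^sub>S \<gamma> b R \<epsilon> K)
    \<le> residual_const p b C\<^sub>S * (1 + Q powr \<alpha>) * L_A p L D R \<epsilon> powr (b + 4)"
proof -
  define l where "l = L_A p L D R \<epsilon>"
  define Y where "Y = 2 + D / R + Q"
  define \<eta> where "\<eta> = prox_step R \<epsilon> K"
  define a where "a = (real p - 1) * \<gamma>"
  define W where "W = L_S p L D (1 / \<eta>) (inner_error R K / \<eta>)"
  have l2: "l \<ge> 2" using L_A_ge_2 assms by (simp add: l_def)
  have Q: "Q > 0" using assms(5-8) by (simp add: Q_def Q_R_def)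
  have \<alpha>: "0 < \<alpha>" "\<alpha> \<le> 1" using assms by (auto simp: \<alpha>_def)
  have Q\<alpha>: "Q powr \<alpha> > 0" "Q powr \<alpha> \<le> 1 + Q"
  proof -
    show "Q powr \<alpha> > 0" using Q by simp
    \<comment> \<open>Weighted AM-GM with second factor 1. It keeps K polynomially bounded in Y, as
      the logarithm estimates need.\<close>
    have "Q powr \<alpha> * 1 powr (1 - \<alpha>) \<le> \<alpha> * Q + (1 - \<alpha>) * 1"
      using \<alpha> Q by (intro Youngs_inequality_0) auto
    also have "\<dots> \<le> 1 * Q + 1" using \<alpha> Q by (intro add_mono mult_right_mono) auto
    finally show "Q powr \<alpha> \<le> 1 + Q" by simp
  qed
  have K: "K \<ge> 2" "Q powr \<alpha> \<le> real K" "real K \<le> 2 + Q powr \<alpha>"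
    unfolding K_def using Q\<alpha>(1) by (auto simp: max_def) linarith+
  have DR: "D / R \<ge> 1" using assms by simp
  have "3 + Q \<le> Y" using DR by (simp add: Y_def)
  then have KY: "real K \<le> Y" "real K + 2 \<le> 2 * Y" using K Q\<alpha> Q by linarith+
  have lY: "l = 1 + ln Y" by (simp add: l_def L_A_def Y_def Q_def Q_R_def)
  have lnK: "ln (real K) \<le> l - 1" using KY K by (simp add: lY ln_mono)
  have W: "W \<le> (real p + 11) * l"
    unfolding W_def \<eta>_def l_def
    using L_S_le_L_A[OF assms(4-8) KY(2)[unfolded Y_def Q_def]] .
  have \<eta>_pos: "\<eta> > 0"
    using assms harm_nonneg[of "K + 1", where ?'a = real]
    by (simp add: \<eta>_def prox_step_def add_pos_nonneg)
  have W1: "W \<ge> 1"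
    unfolding W_def L_S_def using assms \<eta>_pos
    by (simp add: inner_error_def)
  have U: "U_sum a K \<le> 2100 * l ^ 3"
    using U_sum_le[of K a l] K a l2 lnK by (simp add: a_def)
  have U0: "U_sum a K \<ge> 0"
    unfolding U_sum_def by (intro add_nonneg_nonneg mult_nonneg_nonneg sum_nonneg) auto
  have hl: "1 + harm (K + 1) \<le> 2 * l"
  proof -
    have "harm (K + 1) \<le> 1 + ln (real (K + 1))" by (rule harm_le_one_plus_ln) simp
    also have "ln (real (K + 1)) \<le> ln (2 * real K)" using K by (intro ln_mono) auto
    also have "\<dots> = ln 2 + ln (real K)" using K by (simp add: ln_mult)
    also have "\<dots> \<le> l" using lnK ln_le_minus_one[of "2::real"] by simp
    finally show ?thesis using l2 by simp
  qed
  have h0: "harm (K + 1) \<ge> (0::real)" by (rule harm_nonneg)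
  have scale: "(\<eta> * L) powr \<gamma> * R powr a \<le> 16 * l * Q powr \<alpha>"
  proof -
    have "R powr a = (R ^ (p - 1)) powr \<gamma>"
      using assms by (simp add: a_def powr_powr flip: powr_realpow)
    then have "(\<eta> * L) powr \<gamma> * R powr a = (\<eta> * L * R ^ (p - 1)) powr \<gamma>"
      using \<eta>_pos assms by (simp add: powr_mult)
    also have "\<eta> * L * R ^ (p - 1) = 8 * (1 + harm (K + 1)) * (Q / (real K + 1))"
    proof -
      have "R ^ p = R * R ^ (p - 1)" using assms by (cases p) auto
      then show ?thesis by (simp add: \<eta>_def prox_step_def Q_def Q_R_def)
    qed
    also have "(8 * (1 + harm (K + 1)) * (Q / (real K + 1))) powr \<gamma>
        = (8 * (1 + harm (K + 1))) powr \<gamma> * (Q / (real K + 1)) powr \<gamma>"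
      by (rule powr_mult)
    also have "\<dots> \<le> (16 * l) * Q powr \<alpha>"
    proof (intro mult_mono)
      have "(8 * (1 + harm (K + 1))) powr \<gamma> \<le> (8 * (1 + harm (K + 1)) :: real) powr 1"
        using h0 assms by (intro powr_mono) auto
      then show "(8 * (1 + harm (K + 1))) powr \<gamma> \<le> 16 * l" using hl h0 by simp
      have "Q / (real K + 1) \<le> Q / Q powr \<alpha>"
        using K Q Q\<alpha> by (intro divide_left_mono) auto
      also have "\<dots> = Q powr (1 - \<alpha>)" using Q by (simp add: powr_diff)
      finally have "(Q / (real K + 1)) powr \<gamma> \<le> (Q powr (1 - \<alpha>)) powr \<gamma>"
        using Q assms by (intro powr_mono2) auto
      also have "\<dots> = Q powr \<alpha>"
      proof -
        have "(1 - \<alpha>) * \<gamma> = \<alpha>" using assms by (simp add: \<alpha>_def field_simps)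
        then show ?thesis by (simp add: powr_powr)
      qed
      finally show "(Q / (real K + 1)) powr \<gamma> \<le> Q powr \<alpha>" .
    qed (use l2 in auto)
    finally show ?thesis .
  qed
  define M where "M = l ^ 4 * (1 + Q powr \<alpha>)"
  have l4: "1 \<le> l ^ 4" using l2 by (intro one_le_power) auto
  have M1: "1 + Q powr \<alpha> \<le> M" 
  proof -
    have "1 * (1 + Q powr \<alpha>) \<le> l ^ 4 * (1 + Q powr \<alpha>)"
      using l4 Q\<alpha>(1) by (intro mult_right_mono) linarith+
    then show ?thesis by (simp add: M_def)
  qed
  have bracket: "real K + 1 + (\<eta> * L) powr \<gamma> * R powr a * U_sum a K \<le> 33603 * M"
  proof -
    have "(\<eta> * L) powr \<gamma> * R powr a * U_sum a K \<le> (16 * l * Q powr \<alpha>) * (2100 * l ^ 3)"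
      by (rule mult_mono[OF scale U]) (use U0 l2 in auto)
    also have "\<dots> = 33600 * (l ^ 4 * Q powr \<alpha>)" by (simp add: eval_nat_numeral)
    also have "\<dots> \<le> 33600 * M" using l4 by (simp add: M_def algebra_simps)
    finally show ?thesis using K(3) M1 Q\<alpha>(1) by linarith
  qed
  have Wb: "W powr b \<le> (real p + 11) powr b * l powr b"
    using W W1 C l2 by (subst powr_mult[symmetric]) (auto intro: powr_mono2)
  have lb: "1 \<le> (real p + 11) powr b * l powr b"
    using C l2 mult_mono[of 1 "(real p + 11) powr b" 1 "l powr b"] by (simp add: ge_one_powr_ge_zero)
  define N where "N = (real p + 11) powr b * l powr b * M"
  have N1: "1 \<le> N"
    using mult_mono[OF lb, of 1 M] M1 Q\<alpha>(1) by (simp add: N_def)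
  have main: "C\<^sub>S * W powr b * (real K + 1 + (\<eta> * L) powr \<gamma> * R powr a * U_sum a K) \<le> 33603 * C\<^sub>S * N"
  proof -
    have "C\<^sub>S * W powr b * (real K + 1 + (\<eta> * L) powr \<gamma> * R powr a * U_sum a K)
       \<le> C\<^sub>S * ((real p + 11) powr b * l powr b) * (33603 * M)"
      using Wb bracket C U0 by (intro mult_mono) auto
    then show ?thesis by (simp add: N_def mult_ac)
  qed
  have nonneg: "C\<^sub>S * W powr b * (real K + 1 + (\<eta> * L) powr \<gamma> * R powr a * U_sum a K) \<ge> 0"
    using C U0 by simp
  have "real (query_cap p L D C\<^sub>S \<gamma> b R \<epsilon> K)
      = real (nat \<lceil>C\<^sub>S * W powr b * (real K + 1 + (\<eta> * L) powr \<gamma> * R powr a * U_sum a K)\<rceil>) + 1"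
    by (simp add: query_cap_def Let_def W_def \<eta>_def a_def)
  also have "\<dots> \<le> C\<^sub>S * W powr b * (real K + 1 + (\<eta> * L) powr \<gamma> * R powr a * U_sum a K) + 2"
    using nonneg by linarith
  \<comment> \<open>Rounding and the extra query cost 2, which a small \<open>C\<^sub>S\<close>
    cannot absorb; hence the factor 1 + \<open>C\<^sub>S\<close> in
    \<open>residual_const\<close>.\<close>
  also have "\<dots> \<le> 33603 * C\<^sub>S * N + 2 * N" using main N1 by linarith
  also have "\<dots> \<le> 1000000 * (1 + C\<^sub>S) * N"
    using C N1 by (simp add: algebra_simps add_mono)
  also have "\<dots> = residual_const p b C\<^sub>S * (1 + Q powr \<alpha>) * l powr (b + 4)"
    using C l2 by (simp add: residual_const_def N_def M_def powr_add mult_ac)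
  finally show ?thesis by (simp add: l_def)
qed

section \<open>Resolvents and the strong solver\<close>

text \<open>A certificate costs at least one query, however small \<open>\<delta>\<close> is, while \<open>L_S\<close> tends to infinity as \<open>\<delta>\<close>
  tends to zero; a negative \<open>b\<close> is therefore contradictory.\<close>

lemma strong_solver_constants:
  fixes X :: "'a::euclidean_space set"
  assumes "p \<ge> 2" "L > 0" "D > 0" "X \<noteq> {}" "compact X" "convex X"
    and S: "strong_solver p L D X C \<gamma> b S"
  shows "C > 0" "b \<ge> 0"
proof -
  define G :: "'a \<Rightarrow> 'a" where "G = (\<lambda>z. 0 + 1 *\<^sub>R z + 0)"
  have 0: "(\<lambda>_. 0 :: 'a) \<in> operator_class p L X" using assms by (intro zero_in_operator_class) simp
  have G: "G \<in> operator_class p L X"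
    unfolding G_def by (rule operator_class_affine[OF \<open>p \<ge> 2\<close> 0]) simp
  have mono: "strongly_monotone_on 1 X G"
    unfolding G_def using 0 by (intro strongly_monotone_on_affine) (simp add: operator_class_def)
  obtain z where z: "vi_solution X G z"
    using vi_solution_exists[OF assms(4-6) operator_class_continuous[OF G]] .
  then have zX: "z \<in> X" by (simp add: vi_solution_def)
  \<comment> \<open>Started at the solution itself, the bracket of the cost bound is 1: 0^(p - 1) =
    0 as p \<ge> 2, and \<open>0 powr \<gamma>\<close> is 0.\<close>
  have bound: "1 \<le> C * L_S p L D 1 \<delta> powr b" if "\<delta> > 0" for \<delta>
  proof -
    let ?qs = "queries (S z 1 \<delta>) (jet p G)"
    have "certificate X G \<delta> (set ?qs) (result (S z 1 \<delta>) (jet p G))"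
      and len: "real (length ?qs) \<le> C * (1 + (L * norm (z - z) ^ (p - 1) / 1) powr \<gamma>) * L_S p L D 1 \<delta> powr b"
      using S G mono zX z that unfolding strong_solver_def Let_def by (blast intro: zero_less_one)+
    then have "?qs \<noteq> []" by (auto simp: certificate_def)
    then have "1 \<le> length ?qs" by (cases ?qs) auto
    then have "1 \<le> real (length ?qs)" by simp
    then show ?thesis using len assms(1) by (simp add: power_0_left)
  qed
  show C: "C > 0"
    using bound[of 1] by (smt (verit) mult_nonpos_nonneg powr_ge_zero)
  show "b \<ge> 0"
  proof (rule ccontr)
    assume "\<not> b \<ge> 0"
    then have b: "b < 0" by simp
    \<comment> \<open>Chosen so that m^b = 1/(2 C). The accuracy D / exp m then forces
      \<open>L_S\<close> above m, and the bound drops to 1/2.\<close>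
    define m where "m = (2 * C) powr (- 1 / b)"
    have m: "m > 0" using C by (simp add: m_def)
    have "m powr b = (2 * C) powr (- 1 / b * b)" by (simp only: m_def powr_powr)
    also have "\<dots> = (2 * C) powr (- 1)" using b by simp
    also have "\<dots> = 1 / (2 * C)" using C by (simp add: powr_minus_divide)
    finally have mb: "m powr b = 1 / (2 * C)" .
    define \<delta> where "\<delta> = D / exp m"
    have \<delta>: "\<delta> > 0" using assms by (simp add: \<delta>_def)
    have "exp m = 1 * D / \<delta>" using assms by (simp add: \<delta>_def)
    also have "\<dots> \<le> 2 + L * D ^ (p - 1) / 1 + L * D ^ p / \<delta> + 1 * D / \<delta>"
      using assms \<delta> by simp
    finally have "m \<le> ln (2 + L * D ^ (p - 1) / 1 + L * D ^ p / \<delta> + 1 * D / \<delta>)"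
      by (metis exp_gt_zero ln_exp ln_mono)
    then have "m \<le> L_S p L D 1 \<delta>" by (simp add: L_S_def)
    then have "L_S p L D 1 \<delta> powr b \<le> m powr b" using m b by (intro powr_mono2') auto
    then have "C * L_S p L D 1 \<delta> powr b \<le> C * (1 / (2 * C))"
      using C mb by (intro mult_left_mono) auto
    then show False using bound[OF \<delta>] C by simp
  qed
qed

text \<open>Strong monotonicity is tested between y and z: both normal vectors have the favourable
  sign, and Cauchy-Schwarz finishes. With \<mu> = 1/\<eta> and \<delta> = e/\<eta> the error is
  e.\<close>

lemma certificate_error:
  assumes mono: "strongly_monotone_on \<mu> X G" and "\<mu> > 0"
    and cert: "certificate X G \<delta> E (y, n, v)" and z: "vi_solution X G z"
  shows "norm (y - z) \<le> \<delta> / \<mu>"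
proof -
  have y: "y \<in> X" "n \<in> normal_cone X y" "norm (G y + n) \<le> \<delta>"
    using cert by (auto simp: certificate_def)
  obtain m where m: "z \<in> X" "m \<in> normal_cone X z" "G z + m = 0"
    using z by (auto simp: vi_solution_def)
  have "m \<bullet> (y - z) \<le> 0" "n \<bullet> (z - y) \<le> 0" using y m by (auto simp: normal_cone_def)
  moreover have "G z = - m" using m(3) by (simp add: eq_neg_iff_add_eq_0)
  moreover have "(G y - G z) \<bullet> (y - z) \<ge> \<mu> * (norm (y - z))\<^sup>2"
    using mono y m by (simp add: strongly_monotone_on_def)
  ultimately have "\<mu> * (norm (y - z))\<^sup>2 \<le> (G y + n) \<bullet> (y - z)"
    by (simp add: inner_diff_left inner_diff_right inner_add_left)
  also have "\<dots> \<le> norm (G y + n) * norm (y - z)" by (rule norm_cauchy_schwarz)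
  also have "\<dots> \<le> \<delta> * norm (y - z)" using y by (intro mult_right_mono) auto
  finally have le: "(\<mu> * norm (y - z)) * norm (y - z) \<le> \<delta> * norm (y - z)"
    by (simp add: power2_eq_square mult_ac)
  have "\<delta> \<ge> 0" using y(3) norm_ge_zero order_trans by blast
  then have "\<mu> * norm (y - z) \<le> \<delta>" using le by (cases "norm (y - z) = 0") auto
  then show ?thesis using \<open>\<mu> > 0\<close> by (simp add: field_simps)
qed

text \<open>(x - y)/\<eta> lies in F(y) plus the normal cone at y, a monotone relation. So the
  differences of x - y and of y have nonnegative inner product; expand the square of their
  sum.\<close>

lemma resolvent_firmly_nonexpansive:
  fixes X :: "'a::euclidean_space set"
  assumes mono: "monotone_operator_on X F" and "\<eta> > 0"
    and y: "vi_solution X (\<lambda>z. F z + (1 / \<eta>) *\<^sub>R z + - (x /\<^sub>R \<eta>)) y"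
    and y': "vi_solution X (\<lambda>z. F z + (1 / \<eta>) *\<^sub>R z + - (x' /\<^sub>R \<eta>)) y'"
  shows "(norm (y - y'))\<^sup>2 + (norm ((x - y) - (x' - y')))\<^sup>2 \<le> (norm (x - x'))\<^sup>2"
proof -
  obtain n where n: "y \<in> X" "n \<in> normal_cone X y" "F y + (1 / \<eta>) *\<^sub>R y + - (x /\<^sub>R \<eta>) + n = 0"
    using y by (auto simp: vi_solution_def)
  obtain n' where n': "y' \<in> X" "n' \<in> normal_cone X y'" "F y' + (1 / \<eta>) *\<^sub>R y' + - (x' /\<^sub>R \<eta>) + n' = 0"
    using y' by (auto simp: vi_solution_def)
  have step: "u - v = \<eta> *\<^sub>R (f + m)" if "f + (1 / \<eta>) *\<^sub>R v + - (u /\<^sub>R \<eta>) + m = 0" for f m u v :: 'a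
  proof -
    have "f + m = (1 / \<eta>) *\<^sub>R (u - v)"
      using that by (simp add: divide_inverse_commute scaleR_right_diff_distrib algebra_simps)
    then show ?thesis using \<open>\<eta> > 0\<close> by simp
  qed
  have "n \<bullet> (y' - y) \<le> 0" "n' \<bullet> (y - y') \<le> 0" "(F y - F y') \<bullet> (y - y') \<ge> 0"
    using n n' mono by (auto simp: normal_cone_def monotone_operator_on_def)
  then have "0 \<le> ((F y + n) - (F y' + n')) \<bullet> (y - y')"
    by (simp add: inner_diff_left inner_diff_right inner_add_left)
  then have "0 \<le> \<eta> * (((F y + n) - (F y' + n')) \<bullet> (y - y'))" using \<open>\<eta> > 0\<close> by simp
  also have "\<dots> = ((x - y) - (x' - y')) \<bullet> (y - y')"
    unfolding step[OF n(3)] step[OF n'(3)] by (simp flip: scaleR_right_diff_distrib)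
  finally have "0 \<le> ((x - y) - (x' - y')) \<bullet> (y - y')" .
  moreover have "(norm (d + r))\<^sup>2 = (norm d)\<^sup>2 + (norm r)\<^sup>2 + 2 * (r \<bullet> d)" for d r :: 'a
    by (simp add: power2_norm_eq_inner inner_add inner_commute)
  from this[of "y - y'" "(x - y) - (x' - y')"]
  have "(norm (x - x'))\<^sup>2 = (norm (y - y'))\<^sup>2 + (norm ((x - y) - (x' - y')))\<^sup>2
      + 2 * (((x - y) - (x' - y')) \<bullet> (y - y'))" by simp
  ultimately show ?thesis by linarith
qed

lemma inner_call_correct:
  fixes X :: "'a::euclidean_space set"
  assumes "p \<ge> 2" "X \<noteq> {}" "compact X" "convex X"
    and S: "strong_solver p L D X C \<gamma> b S" and F: "F \<in> operator_class p L X"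
    and "x\<^sub>0 \<in> X" "set ys \<subseteq> X" "\<eta> > 0" "\<delta> > 0"
  defines "G \<equiv> (\<lambda>z. F z + (1 / \<eta>) *\<^sub>R z + - (halpern_point x\<^sub>0 ys /\<^sub>R \<eta>))"
    and "qs \<equiv> queries (inner_call X S x\<^sub>0 \<eta> \<delta> ys) (jet p F)"
  shows "set qs \<subseteq> X"
    and "certificate X G \<delta> (set qs) (result (inner_call X S x\<^sub>0 \<eta> \<delta> ys) (jet p F))"
    and "vi_solution X G z \<Longrightarrow> real (length qs) \<le>
      C * (1 + (L * norm (warm_start X x\<^sub>0 ys - z) ^ (p - 1) / (1 / \<eta>)) powr \<gamma>)
        * L_S p L D (1 / \<eta>) \<delta> powr b"
proof -
  let ?w = "warm_start X x\<^sub>0 ys"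
  let ?P = "S ?w (1 / \<eta>) \<delta>"
  have w: "?w \<in> X"
    using assms closest_point_in_set[OF compact_imp_closed[OF \<open>compact X\<close>] \<open>X \<noteq> {}\<close>]
    by (auto simp: warm_start_def split: list.splits)
  have G: "G \<in> operator_class p L X"
    unfolding G_def using assms by (intro operator_class_affine) auto
  have mono: "strongly_monotone_on (1 / \<eta>) X G"
    unfolding G_def using F by (intro strongly_monotone_on_affine) (simp add: operator_class_def)
  have S': "set (queries ?P (jet p G)) \<subseteq> X"
    "certificate X G \<delta> (set (queries ?P (jet p G))) (result ?P (jet p G))"
    "\<And>z. vi_solution X G z \<Longrightarrow> real (length (queries ?P (jet p G))) \<le>
      C * (1 + (L * norm (?w - z) ^ (p - 1) / (1 / \<eta>)) powr \<gamma>) * L_S p L D (1 / \<eta>) \<delta> powr b"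
    using S G mono w \<open>\<eta> > 0\<close> \<open>\<delta> > 0\<close> unfolding strong_solver_def Let_def
    by (meson zero_less_divide_1_iff)+
  obtain U where U: "open U" "X \<subseteq> U" "Ck_on (p - 1) U F"
    using F by (auto simp: operator_class_def)
  \<comment> \<open>The queries meant are those of the run with the oracle of G. The solver's
    guarantee puts them in X, which makes the jet identity available before any run with the oracle
    of F is considered.\<close>
  have jet: "jet p G z = affine_jet (1 / \<eta>) (- (halpern_point x\<^sub>0 ys /\<^sub>R \<eta>)) z (jet p F z)"
    if "z \<in> set (queries ?P (jet p G))" for z
    unfolding G_def using S'(1) that U(2) by (intro jet_affine[OF \<open>p \<ge> 2\<close> U(1,3)]) auto
  note run = lift_affine_run[of ?P "jet p G", OF jet]
  show "set qs \<subseteq> X" "certificate X G \<delta> (set qs) (result (inner_call X S x\<^sub>0 \<eta> \<delta> ys) (jet p F))"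
    "vi_solution X G z \<Longrightarrow> real (length qs) \<le>
      C * (1 + (L * norm (?w - z) ^ (p - 1) / (1 / \<eta>)) powr \<gamma>) * L_S p L D (1 / \<eta>) \<delta> powr b"
    unfolding qs_def inner_call_def using S' by (simp_all add: run)
qed

text \<open>The accumulator of the uncapped loop as a function of the step count, so that single
  inner calls can be addressed by index.\<close>

primrec halpern_traj ::
  "'a set \<Rightarrow> ('a::euclidean_space \<Rightarrow> real \<Rightarrow> real \<Rightarrow> ('a, 'a jet, 'a cert) prog) \<Rightarrow>
   'a \<Rightarrow> real \<Rightarrow> real \<Rightarrow> ('a \<Rightarrow> 'a jet) \<Rightarrow> nat \<Rightarrow> 'a list" where
  "halpern_traj X S x\<^sub>0 \<eta> \<delta> \<omega> 0 = []"
| "halpern_traj X S x\<^sub>0 \<eta> \<delta> \<omega> (Suc t) =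
     fst (result (inner_call X S x\<^sub>0 \<eta> \<delta> (halpern_traj X S x\<^sub>0 \<eta> \<delta> \<omega> t)) \<omega>)
       # halpern_traj X S x\<^sub>0 \<eta> \<delta> \<omega> t"

lemma length_halpern_traj [simp]: "length (halpern_traj X S x\<^sub>0 \<eta> \<delta> \<omega> t) = t"
  by (induction t) auto

lemma queries_halpern_loop:
  "queries (halpern_loop m X S x\<^sub>0 \<epsilon> \<eta> \<delta> (halpern_traj X S x\<^sub>0 \<eta> \<delta> \<omega> t)) \<omega> =
     concat (map (\<lambda>s. queries (inner_call X S x\<^sub>0 \<eta> \<delta> (halpern_traj X S x\<^sub>0 \<eta> \<delta> \<omega> s)) \<omega>) [t..<t + m + 1])"
proof (induction m arbitrary: t)
  case 0
  then show ?case by (simp add: queries_bind_prog case_prod_beta Let_def)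
next
  case (Suc m)
  have "[t..<t + Suc m + 1] = t # [Suc t..<Suc t + m + 1]" by (simp add: upt_conv_Cons del: upt_Suc)
  then show ?case
    using Suc[of "Suc t"] by (simp add: queries_bind_prog case_prod_beta del: upt_Suc)
qed

lemma result_halpern_loop:
  "result (halpern_loop m X S x\<^sub>0 \<epsilon> \<eta> \<delta> (halpern_traj X S x\<^sub>0 \<eta> \<delta> \<omega> t)) \<omega> =
     (let ys = halpern_traj X S x\<^sub>0 \<eta> \<delta> \<omega> (t + m);
          (y, n, g) = result (inner_call X S x\<^sub>0 \<eta> \<delta> ys) \<omega>;
          v = g - (y - halpern_point x\<^sub>0 ys) /\<^sub>R \<eta>
      in if norm (v + n) \<le> \<epsilon> then Some (y, n, v) else None)"
proof (induction m arbitrary: t)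
  case 0
  then show ?case by (simp add: result_bind_prog case_prod_beta Let_def)
next
  case (Suc m)
  then show ?case
    using Suc[of "Suc t"] by (simp add: result_bind_prog case_prod_beta)
qed

section \<open>The extrapolated Halpern construction\<close>

text \<open>Neither the promise nor the cap appears here, and \<eta>, \<delta> are arbitrary:
  soundness of outputs must hold under a false promise.\<close>

locale halpern_run =
  fixes p :: nat and L D C \<gamma> b :: real
    and X :: "'a::euclidean_space set"
    and S :: "'a \<Rightarrow> real \<Rightarrow> real \<Rightarrow> ('a, 'a jet, 'a cert) prog"
    and F :: "'a \<Rightarrow> 'a" and x\<^sub>0 :: 'a and \<eta> \<delta> :: real
  assumes p_ge: "p \<ge> 2" and L_pos: "L > 0" and D_pos: "D > 0"
    and X_ne: "X \<noteq> {}" and X_compact: "compact X" and X_convex: "convex X"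
    and solver: "strong_solver p L D X C \<gamma> b S"
    and F_class: "F \<in> operator_class p L X"
    and x\<^sub>0_in: "x\<^sub>0 \<in> X" and \<eta>_pos: "\<eta> > 0" and \<delta>_pos: "\<delta> > 0"
begin

definition ys where "ys t = halpern_traj X S x\<^sub>0 \<eta> \<delta> (jet p F) t"
definition out where "out t = result (inner_call X S x\<^sub>0 \<eta> \<delta> (ys t)) (jet p F)"
definition qs where "qs t = queries (inner_call X S x\<^sub>0 \<eta> \<delta> (ys t)) (jet p F)"
definition x where "x t = halpern_point x\<^sub>0 (ys t)"
definition yh where "yh t = fst (out t)"
definition w where "w t = warm_start X x\<^sub>0 (ys t)"
definition G where "G t = (\<lambda>z. F z + (1 / \<eta>) *\<^sub>R z + - (x t /\<^sub>R \<eta>))"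
definition y where "y t = (SOME z. vi_solution X (G t) z)"

lemma ys_simps: "ys 0 = []" "ys (Suc t) = yh t # ys t" "length (ys t) = t"
  by (simp_all add: ys_def yh_def out_def)

lemma ys_subset: "set (ys t) \<subseteq> X"
proof (induction t)
  case (Suc t)
  have "certificate X (G t) \<delta> (set (qs t)) (out t)"
    unfolding G_def x_def qs_def out_def
    by (rule inner_call_correct(2)[OF p_ge X_ne X_compact X_convex solver F_class x\<^sub>0_in Suc \<eta>_pos \<delta>_pos])
  then have "yh t \<in> X" by (auto simp: certificate_def yh_def)
  then show ?case using Suc by (simp add: ys_simps)
qed (simp add: ys_simps)

lemmas inner_call = inner_call_correct[OF p_ge X_ne X_compact X_convex solver F_class x\<^sub>0_in
    ys_subset \<eta>_pos \<delta>_pos, folded x_def, folded G_def qs_def out_def w_def]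

lemma vi_solution_y: "vi_solution X (G t) (y t)"
proof -
  have "G t \<in> operator_class p L X"
    unfolding G_def using \<eta>_pos by (intro operator_class_affine[OF p_ge F_class]) simp
  then obtain z where "vi_solution X (G t) z"
    using vi_solution_exists[OF X_ne X_compact X_convex operator_class_continuous] by metis
  then show ?thesis unfolding y_def by (rule someI)
qed

lemma F_monotone: "monotone_operator_on X F"
  using F_class by (simp add: operator_class_def)

lemma yh_error: "norm (yh t - y t) \<le> \<eta> * \<delta>"
proof -
  obtain v n g where out: "out t = (v, n, g)" by (metis prod_cases3)
  have "strongly_monotone_on (1 / \<eta>) X (G t)"
    unfolding G_def by (rule strongly_monotone_on_affine[OF F_monotone])
  then have "norm (v - y t) \<le> \<delta> / (1 / \<eta>)"
    using certificate_error[OF _ _ _ vi_solution_y] inner_call(2)[of t] \<eta>_pos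
    unfolding out by (metis zero_less_divide_1_iff)
  then show ?thesis by (simp add: yh_def out mult.commute)
qed

lemma queries_loop:
  "queries (halpern_loop K X S x\<^sub>0 \<epsilon> \<eta> \<delta> []) (jet p F) = concat (map qs [0..<K + 1])"
  using queries_halpern_loop[of K X S x\<^sub>0 \<epsilon> \<eta> \<delta> "jet p F" 0]
  by (simp add: qs_def[abs_def] ys_def del: upt_Suc)

text \<open>The last inner certificate contains the value of G_K at its point; subtracting the known
  affine part recovers F there without another query.\<close>

lemma result_loop:
  "result (halpern_loop K X S x\<^sub>0 \<epsilon> \<eta> \<delta> []) (jet p F) =
     (let (v, n, g) = out K in if norm (F v + n) \<le> \<epsilon> then Some (v, n, F v) else None)"
proof -
  obtain v n g where out: "out K = (v, n, g)" by (metis prod_cases3)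
  then have "g = G K v" using inner_call(2)[of K] by (simp add: certificate_def)
  then have "g - (v - x K) /\<^sub>R \<eta> = F v"
    by (simp add: G_def algebra_simps divide_inverse)
  then show ?thesis
    using result_halpern_loop[of K X S x\<^sub>0 \<epsilon> \<eta> \<delta> "jet p F" 0] out
    by (simp add: out_def ys_def x_def Let_def)
qed

lemma loop_queries_subset: "set (queries (halpern_loop K X S x\<^sub>0 \<epsilon> \<eta> \<delta> []) (jet p F)) \<subseteq> X"
  using inner_call(1) by (auto simp: queries_loop simp del: upt_Suc)

lemma loop_certificate:
  assumes "result (halpern_loop K X S x\<^sub>0 \<epsilon> \<eta> \<delta> []) (jet p F) = Some c"
  shows "certificate X F \<epsilon> (set (queries (halpern_loop K X S x\<^sub>0 \<epsilon> \<eta> \<delta> []) (jet p F))) c"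
proof -
  obtain v n g where out: "out K = (v, n, g)" by (metis prod_cases3)
  have c: "c = (v, n, F v)" "norm (F v + n) \<le> \<epsilon>"
    using assms by (auto simp: result_loop out split: if_splits)
  have "v \<in> X" "n \<in> normal_cone X v" "v \<in> set (qs K)"
    using inner_call(2)[of K] by (auto simp: out certificate_def)
  then show ?thesis using c by (auto simp: certificate_def queries_loop)
qed

text \<open>From here on the distance promise and the prescribed \<eta>, \<delta> are in
  force.\<close>

context
  fixes zs :: 'a and R \<epsilon> :: real and K :: nat
  assumes zs: "vi_solution X F zs" and promise: "norm (x\<^sub>0 - zs) \<le> R"
    and R_pos: "R > 0" and K_ge: "K \<ge> 2" and \<epsilon>_pos: "\<epsilon> > 0"
    and \<eta>_eq: "\<eta> = prox_step R \<epsilon> K" and \<delta>_eq: "\<delta> = inner_error R K / \<eta>"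
begin

lemma inexact_halpern: "inexact_halpern x y yh zs R (inner_error R K) K"
proof
  fix s t
  show "x (Suc t) = (x 0 + (real t + 1) *\<^sub>R yh t) /\<^sub>R (real t + 2)"
    by (simp add: x_def halpern_point_def ys_simps add_ac)
  show "norm (yh t - y t) \<le> inner_error R K"
    using yh_error[of t] \<eta>_pos by (simp add: \<delta>_eq)
  show "(norm (y s - y t))\<^sup>2 + (norm ((x s - y s) - (x t - y t)))\<^sup>2 \<le> (norm (x s - x t))\<^sup>2"
    using resolvent_firmly_nonexpansive[OF F_monotone \<eta>_pos] vi_solution_y
    unfolding G_def by blast
  \<comment> \<open>With centre \<open>zs\<close> the affine part vanishes at \<open>zs\<close>, so
    \<open>zs\<close> is a fixed point of the resolvent, and \<open>fejer\<close> is firmness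
    against it.\<close>
  have "vi_solution X (\<lambda>z. F z + (1 / \<eta>) *\<^sub>R z + - (zs /\<^sub>R \<eta>)) zs"
    using zs by (simp add: vi_solution_def divide_inverse)
  then have "(norm (y t - zs))\<^sup>2 + (norm ((x t - y t) - (zs - zs)))\<^sup>2 \<le> (norm (x t - zs))\<^sup>2"
    using resolvent_firmly_nonexpansive[OF F_monotone \<eta>_pos] vi_solution_y
    unfolding G_def by blast
  then have "(norm (y t - zs))\<^sup>2 \<le> (norm (x t - zs))\<^sup>2" by (smt (verit) zero_le_power2)
  then show "norm (y t - zs) \<le> norm (x t - zs)" by simp
  show "norm (x 0 - zs) \<le> R" using promise by (simp add: x_def halpern_point_def ys_simps)
qed (use R_pos K_ge in auto)

interpretation inexact_halpern x y yh zs R "inner_error R K" K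
  by (rule inexact_halpern)

lemma loop_succeeds: "result (halpern_loop K X S x\<^sub>0 \<epsilon> \<eta> \<delta> []) (jet p F) \<noteq> None"
proof -
  obtain v n g where out: "out K = (v, n, g)" by (metis prod_cases3)
  have v: "yh K = v" by (simp add: yh_def out)
  have res: "norm (G K v + n) \<le> \<delta>"
    using inner_call(2)[of K] by (auto simp: out certificate_def)
  have "F v + n = (G K v + n) + (1 / \<eta>) *\<^sub>R (x K - v)"
    by (simp add: G_def algebra_simps divide_inverse)
  then have "norm (F v + n) \<le> norm (G K v + n) + norm ((1 / \<eta>) *\<^sub>R (x K - v))"
    by (metis norm_triangle_ineq)
  also have "\<dots> \<le> \<delta> + norm (x K - v) / \<eta>" using res \<eta>_pos by simp
  also have "\<dots> = (inner_error R K + norm (x K - v)) / \<eta>"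
    by (simp add: \<delta>_eq add_divide_distrib)
  also have "\<dots> \<le> (8 * R * (1 + harm (K + 1)) / (real K + 1)) / \<eta>"
    using final_residual \<eta>_pos unfolding v by (intro divide_right_mono) auto
  also have "8 * R * (1 + harm (K + 1)) / (real K + 1) = \<epsilon> * \<eta>"
    using \<epsilon>_pos by (simp add: \<eta>_eq prox_step_def)
  finally show ?thesis using \<eta>_pos by (simp add: result_loop out)
qed

text \<open>Projection is nonexpansive and fixes \<open>y t\<close>, which lies in X.\<close>

lemma warm_start_distance:
  assumes "t \<ge> 2"
  shows "norm (w t - y t) \<le> norm (2 *\<^sub>R yh (t - 1) - yh (t - 2) - y t)"
proof -
  obtain s where t: "t = Suc (Suc s)" using assms by (metis add_2_eq_Suc le_Suc_ex)
  have cl: "closed X" using X_compact by (rule compact_imp_closed)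
  have "y t \<in> X" using vi_solution_y by (simp add: vi_solution_def)
  then have "closest_point X (y t) = y t" by (rule closest_point_self)
  moreover have "w t = closest_point X (2 *\<^sub>R yh (t - 1) - yh (t - 2))"
    by (simp add: w_def warm_start_def t ys_simps)
  ultimately show ?thesis
    using closest_point_lipschitz[OF X_convex cl X_ne, of "2 *\<^sub>R yh (t - 1) - yh (t - 2)" "y t"]
    by (simp add: dist_norm)
qed

lemma sum_warm_start_distance:
  assumes "0 < a" "a \<le> 2"
  shows "(\<Sum>t=0..K. norm (w t - y t) powr a) \<le> R powr a * U_sum a K"
proof (rule sum_powr_le_U_sum)
  have "w 0 = x 0" by (simp add: w_def x_def warm_start_def halpern_point_def ys_simps)
  then show "norm (w 0 - y 0) \<le> 3 * R" using first_steps(1) by simp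
  have "w 1 = yh 0" by (simp add: w_def warm_start_def ys_simps)
  then show "norm (w 1 - y 1) \<le> 3 * R" using first_steps(2) by simp
  fix T n :: nat assume T: "2 \<le> T" "T \<le> n" "n < 2 * T" "n \<le> K"
  have "(\<Sum>t=T..n. (norm (w t - y t))\<^sup>2)
      \<le> (\<Sum>t=T..n. (norm (2 *\<^sub>R yh (t - 1) - yh (t - 2) - y t))\<^sup>2)"
    using T by (intro sum_mono power_mono warm_start_distance) auto
  then show "(\<Sum>t=T..n. (norm (w t - y t))\<^sup>2) \<le> 64 * R\<^sup>2 * (harm (2 * T))\<^sup>2 / (real T)\<^sup>2"
    using second_difference_block[OF T] by linarith
qed (use assms R_pos K_ge in auto)

lemma loop_cost:
  assumes \<gamma>: "0 < \<gamma>" "(real p - 1) * \<gamma> \<le> 2" and C: "C > 0"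
  defines "a \<equiv> (real p - 1) * \<gamma>"
  shows "real (length (queries (halpern_loop K X S x\<^sub>0 \<epsilon> \<eta> \<delta> []) (jet p F)))
    \<le> C * L_S p L D (1 / \<eta>) \<delta> powr b * (real K + 1 + (\<eta> * L) powr \<gamma> * R powr a * U_sum a K)"
proof -
  let ?W = "L_S p L D (1 / \<eta>) \<delta> powr b"
  have a: "0 < a" "a \<le> 2" using \<gamma> p_ge by (auto simp: a_def)
  have pow: "(L * r ^ (p - 1) / (1 / \<eta>)) powr \<gamma> = (\<eta> * L) powr \<gamma> * r powr a" if "r \<ge> 0" for r :: real
  proof -
    have "(r ^ (p - 1)) powr \<gamma> = r powr a"
    \<comment> \<open>\<open>powr\<close> agrees with powers only for a positive base; at 0 both
      sides vanish because p \<ge> 2.\<close>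
    proof (cases "r = 0")
      case True
      then show ?thesis using p_ge by (simp add: power_0_left)
    next
      case False
      then have "r ^ (p - 1) = r powr (real p - 1)"
        using that p_ge powr_realpow[of r "p - 1"] by (simp add: of_nat_diff)
      then show ?thesis by (simp add: powr_powr a_def)
    qed
    moreover have "L * r ^ (p - 1) / (1 / \<eta>) = (\<eta> * L) * r ^ (p - 1)" by simp
    ultimately show ?thesis by (simp only: powr_mult)
  qed
  have "real (length (queries (halpern_loop K X S x\<^sub>0 \<epsilon> \<eta> \<delta> []) (jet p F))) = (\<Sum>t=0..K. real (length (qs t)))"
    unfolding queries_loop length_concat
    by (simp add: comp_def interv_sum_list_conv_sum_set_nat atLeastLessThanSuc_atLeastAtMost del: upt_Suc)
  also have "\<dots> \<le> (\<Sum>t=0..K. C * ?W * (1 + (\<eta> * L) powr \<gamma> * norm (w t - y t) powr a))"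
  proof (rule sum_mono)
    fix t
    show "real (length (qs t)) \<le> C * ?W * (1 + (\<eta> * L) powr \<gamma> * norm (w t - y t) powr a)"
      using inner_call(3)[OF vi_solution_y, of t] unfolding pow[OF norm_ge_zero] by (simp add: mult_ac)
  qed
  also have "\<dots> = C * ?W * (real K + 1 + (\<eta> * L) powr \<gamma> * (\<Sum>t=0..K. norm (w t - y t) powr a))"
    by (simp add: sum.distrib flip: sum_distrib_left)
  also have "\<dots> \<le> C * ?W * (real K + 1 + (\<eta> * L) powr \<gamma> * (R powr a * U_sum a K))"
    using C sum_warm_start_distance[OF a]
    by (intro mult_left_mono add_left_mono) auto
  finally show ?thesis by (simp add: mult.assoc)
qed

end

end

theorem theorem8p1:
  fixes p :: nat and L D C\<^sub>S \<gamma> b :: real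
    and X :: "'a::euclidean_space set"
    and S :: "'a \<Rightarrow> real \<Rightarrow> real \<Rightarrow> ('a, 'a jet, 'a cert) prog"
  assumes "p \<ge> 2" and "L > 0" and "D > 0"
    and "X \<noteq> {}" and "compact X" and "convex X" and "diameter X \<le> D"
    and "0 < \<gamma>" and "\<gamma> \<le> 1"
    and "(real p - 1) * \<gamma> \<le> 2" and "3 / 2 * ((real p - 1) * \<gamma>) \<ge> 1"
    and "strong_solver p L D X C\<^sub>S \<gamma> b S"
  shows "residual_solver p L D X (residual_const p b C\<^sub>S) (\<gamma> / (1 + \<gamma>)) (b + 4)
           (\<lambda>x\<^sub>0 R \<epsilon>. halpern p L D X C\<^sub>S \<gamma> b S
              (max 2 (nat \<lceil>Q_R p L R \<epsilon> powr (\<gamma> / (1 + \<gamma>))\<rceil>)) x\<^sub>0 R \<epsilon>)"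
  unfolding residual_solver_def
proof (intro allI impI, elim conjE, intro conjI ballI)
  fix x\<^sub>0 :: 'a and R \<epsilon> :: real
  assume inst: "x\<^sub>0 \<in> X" "0 < R" "R \<le> D" "0 < \<epsilon>"
  define K where "K = max 2 (nat \<lceil>Q_R p L R \<epsilon> powr (\<gamma> / (1 + \<gamma>))\<rceil>)"
  define B where "B = query_cap p L D C\<^sub>S \<gamma> b R \<epsilon> K"
  define \<eta> where "\<eta> = prox_step R \<epsilon> K"
  define \<delta> where "\<delta> = inner_error R K / \<eta>"
  define P where "P = halpern_loop K X S x\<^sub>0 \<epsilon> \<eta> \<delta> []"
  have C: "C\<^sub>S > 0" "b \<ge> 0"
    using strong_solver_constants[OF assms(1-6) assms(12)] by auto
  have algo: "halpern p L D X C\<^sub>S \<gamma> b S K x\<^sub>0 R \<epsilon> = capped P B"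
    by (simp add: halpern_def P_def B_def \<eta>_def \<delta>_def Let_def)
  show "\<exists>B::nat.
      real B \<le> residual_const p b C\<^sub>S * (1 + Q_R p L R \<epsilon> powr (\<gamma> / (1 + \<gamma>))) * L_A p L D R \<epsilon> powr (b + 4) \<and>
      (\<forall>oracle. length (queries (halpern p L D X C\<^sub>S \<gamma> b S
        (max 2 (nat \<lceil>Q_R p L R \<epsilon> powr (\<gamma> / (1 + \<gamma>))\<rceil>)) x\<^sub>0 R \<epsilon>) oracle) \<le> B)"
    \<comment> \<open>Capping truncates the query list whatever the oracle answers, so only the size
      of the cap has to be estimated.\<close>
    unfolding K_def[symmetric] algo queries_capped
    using query_cap_le[OF assms(1,2) inst(2-4) assms(8-11) C, folded K_def B_def]
    by (intro exI[of _ B]) auto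
  fix F assume F: "F \<in> operator_class p L X"
  have \<eta>: "\<eta> > 0"
    using inst harm_nonneg[of "K + 1", where ?'a = real]
    by (simp add: \<eta>_def prox_step_def add_pos_nonneg)
  then have \<delta>: "\<delta> > 0" using inst by (simp add: \<delta>_def inner_error_def)
  interpret halpern_run p L D C\<^sub>S \<gamma> b X S F x\<^sub>0 \<eta> \<delta>
    by unfold_locales (use assms inst F \<eta> \<delta> in auto)
  let ?qs = "queries (capped P B) (jet p F)" and ?out = "result (capped P B) (jet p F)"
  have "set ?qs \<subseteq> X"
    using loop_queries_subset[of K \<epsilon>] set_take_subset unfolding queries_capped P_def by fastforce
  moreover have "certificate X F \<epsilon> (set ?qs) c" if "?out = Some c" for c
    using loop_certificate[of K \<epsilon> c] that
    by (auto simp: result_capped queries_capped P_def split: if_splits)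
  moreover have "?out \<noteq> None" if "vi_solution X F z" "norm (x\<^sub>0 - z) \<le> R" for z
  proof -
    have K: "K \<ge> 2" by (simp add: K_def)
    note run = that inst(2) K inst(4) \<eta>_def \<delta>_def
    let ?B = "C\<^sub>S * L_S p L D (1 / \<eta>) \<delta> powr b *
      (real K + 1 + (\<eta> * L) powr \<gamma> * R powr ((real p - 1) * \<gamma>) * U_sum ((real p - 1) * \<gamma>) K)"
    \<comment> \<open>Under the promise the uncapped run fits into the cap, so capping leaves its
      result unchanged.\<close>
    have "real (length (queries P (jet p F))) \<le> ?B"
      unfolding P_def by (rule loop_cost[OF run assms(8,10) C(1)])
    moreover have "B = nat \<lceil>?B\<rceil> + 1"
      by (simp add: B_def query_cap_def Let_def \<eta>_def \<delta>_def)
    ultimately have "length (queries P (jet p F)) \<le> B" by linarith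
    then show ?thesis using loop_succeeds[OF run] by (simp add: result_capped P_def)
  qed
  ultimately show "let qs = set (queries (halpern p L D X C\<^sub>S \<gamma> b S
          (max 2 (nat \<lceil>Q_R p L R \<epsilon> powr (\<gamma> / (1 + \<gamma>))\<rceil>)) x\<^sub>0 R \<epsilon>) (jet p F));
        out = result (halpern p L D X C\<^sub>S \<gamma> b S
          (max 2 (nat \<lceil>Q_R p L R \<epsilon> powr (\<gamma> / (1 + \<gamma>))\<rceil>)) x\<^sub>0 R \<epsilon>) (jet p F)
      in qs \<subseteq> X \<and> (\<forall>c. out = Some c \<longrightarrow> certificate X F \<epsilon> qs c) \<and>
        ((\<exists>z. vi_solution X F z \<and> norm (x\<^sub>0 - z) \<le> R) \<longrightarrow> out \<noteq> None)"
    unfolding K_def[symmetric] algo Let_def by blast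
qed

end
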